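(* Let $G$ be a finite group acting transitively on a finite set $X$ via $\sigma\colon G\to S_X$. Fix $x_0\in X$ with stabilizer $H\le G$, and select $\{t_x\}_{x\in X}\subseteq G$ with $\sigma(t_x)x_0=x$ for each $x$. Let $\mathbb{F}\in\{\mathbb{R},\mathbb{C}\}$ and let $\rho_i\colon G\to\operatorname{U}(\mathbb{F}^{d_i})$, $i\in[\ell]$, be pairwise inequivalent irreducible unitary representations. Suppose $\pi\colon H\to\operatorname{U}(\mathbb{F}^r)$ is a unitary representation (not necessarily irreducible) and $\Psi_i\in\mathbb{F}^{d_i\times r}$ are isometries with $\rho_i(h)\Psi_i=\Psi_i\pi(h)$ for all $i\in[\ell]$, $h\in H$. Put $d:=\sum_{i\in[\ell]}d_i$ and $\rho:=\bigoplus_{i\in[\ell]}\rho_i\colon G\to\operatorname{U}(\mathbb{F}^d)$. Then the vertical concatenation \[\begin{bmatrix}\sqrt{d_1/d}\,\Psi_1\\ \vdots\\ \sqrt{d_\ell/d}\,\Psi_\ell\end{bmatrix}\in\mathbb{F}^{d\times r}\] is an isometry onto a subspace $W\le\mathbb{F}^d$, and the ensemble $\mathcal{W}:=\{\rho(t_x)W\}_{x\in X}$ is a tight fusion frame for $\mathbb{F}^d$ whose automorphism group contains $\sigma(G)\le S_X$. Furthermore, if $G$ acts doubly homogeneously on $X$, then: (a) $\mathcal{W}$ is an equi-chordal tight fusion frame; and (b) when $|X|\ge2$, $\mathcal{W}$ is an equi-isoclinic tight fusion frame if and only if there exists $g\in G\setminus H$ such that $W$ and $\rho(g)W$ are iso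clinic.
   Context: For an ensemble $\{W_x\}_{x\in X}$ of $r$-dimensional subspaces of a finite-dimensional Hilbert space $V$ over $\mathbb{F}$, it is a tight fusion frame if the sum of the orthogonal projections onto the $W_x$ is a scalar multiple of the identity. For isometries $\Phi_x\colon\mathbb{F}^r\to V$ with image $W_x$, $W_x,W_y$ are $\alpha$-isoclinic if $(\Phi_x^*\Phi_y)^*(\Phi_x^*\Phi_y)=\alpha I$ ("isoclinic" means $\alpha$-isoclinic for some $\alpha$); the ensemble is equi-isoclinic if one $\alpha$ works for all pairs $x\ne y$. Chordal distance: $\operatorname{dist}_c(W_x,W_y)=\sqrt{r-\|\Phi_x^*\Phi_y\|_F^2}$. An equi-chordal tight fusion frame is a tight fusion frame with all pairwise chordal distances equal; an equi-isoclinic tight fusion frame is a tight fusion frame that is equi-isoclinic. The automorphism group of the ensemble is the set of $\tau\in S_X$ for which some unitary $U$ of $V$ satisfies $UW_x=W_{\tau(x)}$ for all $x$. $G$ acts doubly homogeneously on $X$ if for any two unordered pairs $\{x,y\},\{x',y'\}$ of distinct points there is $g\in G$ with $\{\sigma(g)x,\sigma(g)y\}=\{x',y'\}$. *)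

theory Defs
  imports
    "Jordan_Normal_Form.Schur_Decomposition"
    "HOL-Algebra.Group_Action"
begin

text \<open>
  The scalar field is the real or the complex numbers.  The class axioms say that \<open>to_complex\<close>
  is an isometric, conjugation-preserving isomorphism of real algebras onto \<open>\<real>\<close> or onto all of
  the complex numbers, so up to isomorphism \<open>real\<close> and \<open>complex\<close> are its only instances.
\<close>

class real_or_complex = conjugatable_ordered_field + real_normed_field +
  fixes to_complex :: "'a \<Rightarrow> complex"
  assumes to_complex_add: "to_complex (a + b) = to_complex a + to_complex b"
    and to_complex_mult: "to_complex (a * b) = to_complex a * to_complex b"
    and to_complex_scaleR: "to_complex (c *\<^sub>R a) = c *\<^sub>R to_complex a"
    and to_complex_conjugate: "to_complex (conjugate a) = cnj (to_complex a)"
    and norm_to_complex: "norm (to_complex a) = norm a"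
    and range_to_complex: "range to_complex = \<real> \<or> range to_complex = UNIV"

instantiation real :: real_or_complex
begin
definition "to_complex (a :: real) = complex_of_real a"
instance
  by intro_classes (auto simp: to_complex_real_def Reals_def scaleR_conv_of_real)
end

instantiation complex :: real_or_complex
begin
definition "to_complex (a :: complex) = a"
instance
  by intro_classes (auto simp: to_complex_complex_def)
end

lemma inj_to_complex: "inj (to_complex :: 'a::real_or_complex \<Rightarrow> complex)"
proof (rule injI)
  fix a b :: 'a
  assume eq: "to_complex a = to_complex b"
  have "to_complex a = to_complex (a - b) + to_complex b"
    by (simp flip: to_complex_add)
  with eq have "to_complex (a - b) = 0"
    by simp
  then show "a = b"
    using norm_to_complex[of "a - b"] by simp
qed

abbreviation is_subspace :: "nat \<Rightarrow> 'a::field vec set \<Rightarrow> bool" where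
  "is_subspace d W \<equiv> VectorSpace.subspace class_ring W (module_vec TYPE('a) d)"

definition subspace_dim :: "nat \<Rightarrow> 'a::field vec set \<Rightarrow> nat" where
  "subspace_dim d W = vectorspace.dim class_ring ((module_vec TYPE('a) d)\<lparr>carrier := W\<rparr>)"

definition mat_image :: "'a::semiring_0 mat \<Rightarrow> 'a vec set" where
  "mat_image A = (\<lambda>v. A *\<^sub>v v) ` carrier_vec (dim_col A)"

definition is_isometry :: "nat \<Rightarrow> nat \<Rightarrow> 'a::conjugatable_field mat \<Rightarrow> bool" where
  "is_isometry d r \<Phi> \<longleftrightarrow> \<Phi> \<in> carrier_mat d r \<and> mat_adjoint \<Phi> * \<Phi> = 1\<^sub>m r"

definition isometry_onto :: "nat \<Rightarrow> nat \<Rightarrow> 'a::conjugatable_field mat \<Rightarrow> 'a vec set \<Rightarrow> bool" where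
  "isometry_onto d r \<Phi> W \<longleftrightarrow> is_isometry d r \<Phi> \<and> mat_image \<Phi> = W"

definition orth_projection :: "nat \<Rightarrow> 'a::conjugatable_field mat \<Rightarrow> 'a vec set \<Rightarrow> bool" where
  "orth_projection d P W \<longleftrightarrow>
     P \<in> carrier_mat d d \<and> P * P = P \<and> mat_adjoint P = P \<and> mat_image P = W"

definition frobenius_norm :: "'a::real_normed_vector mat \<Rightarrow> real" where
  "frobenius_norm A = sqrt (\<Sum>i<dim_row A. \<Sum>j<dim_col A. (norm (A $$ (i, j)))\<^sup>2)"

definition stack_rows :: "nat \<Rightarrow> 'a::zero mat list \<Rightarrow> 'a mat" where
  "stack_rows r As = foldr (@\<^sub>r) As (0\<^sub>m 0 r)"

definition unitary_group :: "nat \<Rightarrow> 'a::conjugatable_field mat monoid" where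
  "unitary_group d =
     \<lparr>carrier = {U \<in> carrier_mat d d. mat_adjoint U * U = 1\<^sub>m d \<and> U * mat_adjoint U = 1\<^sub>m d},
      monoid.mult = (*), one = 1\<^sub>m d\<rparr>"

definition irreducible_rep :: "('g, 'b) monoid_scheme \<Rightarrow> nat \<Rightarrow> ('g \<Rightarrow> 'a::field mat) \<Rightarrow> bool" where
  "irreducible_rep G d \<rho> \<longleftrightarrow> d > 0 \<and>
     (\<forall>S. is_subspace d S \<and> (\<forall>g\<in>carrier G. \<forall>v\<in>S. \<rho> g *\<^sub>v v \<in> S)
        \<longrightarrow> S = {0\<^sub>v d} \<or> S = carrier_vec d)"

definition equivalent_reps ::
  "('g, 'b) monoid_scheme \<Rightarrow> nat \<Rightarrow> ('g \<Rightarrow> 'a::field mat) \<Rightarrow> nat \<Rightarrow> ('g \<Rightarrow> 'a mat) \<Rightarrow> bool" where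
  "equivalent_reps G d \<rho> d' \<rho>' \<longleftrightarrow>
     (\<exists>T \<in> carrier_mat d' d. invertible_mat T \<and> (\<forall>g\<in>carrier G. T * \<rho> g = \<rho>' g * T))"

definition doubly_homogeneous ::
  "('g, 'b) monoid_scheme \<Rightarrow> 'x set \<Rightarrow> ('g \<Rightarrow> 'x \<Rightarrow> 'x) \<Rightarrow> bool" where
  "doubly_homogeneous G X \<sigma> \<longleftrightarrow>
     (\<forall>x\<in>X. \<forall>y\<in>X. \<forall>x'\<in>X. \<forall>y'\<in>X. x \<noteq> y \<and> x' \<noteq> y' \<longrightarrow>
        (\<exists>g\<in>carrier G. {\<sigma> g x, \<sigma> g y} = {x', y'}))"

definition tight_fusion_frame ::
  "nat \<Rightarrow> nat \<Rightarrow> 'x set \<Rightarrow> ('x \<Rightarrow> 'a::real_or_complex vec set) \<Rightarrow> bool" where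
  "tight_fusion_frame d r X W \<longleftrightarrow>
     (\<forall>x\<in>X. is_subspace d (W x) \<and> subspace_dim d (W x) = r) \<and>
     (\<exists>P c. (\<forall>x\<in>X. orth_projection d (P x) (W x)) \<and>
        mat d d (\<lambda>(i, j). \<Sum>x\<in>X. P x $$ (i, j)) = c \<cdot>\<^sub>m 1\<^sub>m d)"

text \<open>
  The next two notions do not depend on the isometries: any two isometries onto the same subspace
  differ by a unitary factor on the right.
\<close>

definition alpha_isoclinic ::
  "nat \<Rightarrow> nat \<Rightarrow> 'a::real_or_complex \<Rightarrow> 'a vec set \<Rightarrow> 'a vec set \<Rightarrow> bool" where
  "alpha_isoclinic d r \<alpha> W W' \<longleftrightarrow>
     (\<exists>\<Phi> \<Phi>'. isometry_onto d r \<Phi> W \<and> isometry_onto d r \<Phi>' W' \<and>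
        mat_adjoint (mat_adjoint \<Phi> * \<Phi>') * (mat_adjoint \<Phi> * \<Phi>') = \<alpha> \<cdot>\<^sub>m 1\<^sub>m r)"

definition chordal_dist ::
  "nat \<Rightarrow> nat \<Rightarrow> 'a::real_or_complex vec set \<Rightarrow> 'a vec set \<Rightarrow> real" where
  "chordal_dist d r W W' =
     (let \<Phi> = (SOME \<Phi>. isometry_onto d r \<Phi> W); \<Phi>' = (SOME \<Phi>'. isometry_onto d r \<Phi>' W')
      in sqrt (real r - (frobenius_norm (mat_adjoint \<Phi> * \<Phi>'))\<^sup>2))"

definition isoclinic ::
  "nat \<Rightarrow> nat \<Rightarrow> 'a::real_or_complex vec set \<Rightarrow> 'a vec set \<Rightarrow> bool" where
  "isoclinic d r W W' \<longleftrightarrow> (\<exists>\<alpha>. alpha_isoclinic d r \<alpha> W W')"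

definition equi_isoclinic ::
  "nat \<Rightarrow> nat \<Rightarrow> 'x set \<Rightarrow> ('x \<Rightarrow> 'a::real_or_complex vec set) \<Rightarrow> bool" where
  "equi_isoclinic d r X W \<longleftrightarrow>
     (\<exists>\<alpha>. \<forall>x\<in>X. \<forall>y\<in>X. x \<noteq> y \<longrightarrow> alpha_isoclinic d r \<alpha> (W x) (W y))"

definition equi_chordal ::
  "nat \<Rightarrow> nat \<Rightarrow> 'x set \<Rightarrow> ('x \<Rightarrow> 'a::real_or_complex vec set) \<Rightarrow> bool" where
  "equi_chordal d r X W \<longleftrightarrow>
     (\<exists>\<delta>. \<forall>x\<in>X. \<forall>y\<in>X. x \<noteq> y \<longrightarrow> chordal_dist d r (W x) (W y) = \<delta>)"

definition equi_chordal_tff ::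
  "nat \<Rightarrow> nat \<Rightarrow> 'x set \<Rightarrow> ('x \<Rightarrow> 'a::real_or_complex vec set) \<Rightarrow> bool" where
  "equi_chordal_tff d r X W \<longleftrightarrow> tight_fusion_frame d r X W \<and> equi_chordal d r X W"

definition equi_isoclinic_tff ::
  "nat \<Rightarrow> nat \<Rightarrow> 'x set \<Rightarrow> ('x \<Rightarrow> 'a::real_or_complex vec set) \<Rightarrow> bool" where
  "equi_isoclinic_tff d r X W \<longleftrightarrow> tight_fusion_frame d r X W \<and> equi_isoclinic d r X W"

definition ensemble_automorphisms ::
  "nat \<Rightarrow> 'x set \<Rightarrow> ('x \<Rightarrow> 'a::conjugatable_field vec set) \<Rightarrow> ('x \<Rightarrow> 'x) set" where
  "ensemble_automorphisms d X W =
     {\<tau> \<in> carrier (BijGroup X).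
        \<exists>U \<in> carrier (unitary_group d). \<forall>x\<in>X. (\<lambda>v. U *\<^sub>v v) ` W x = W (\<tau> x)}"

end

theory Submission
  imports Defs "Jordan_Normal_Form.Spectral_Radius"
begin

text \<open>
  The frame operator, i.e. the sum of the projections onto the subspaces \<open>\<rho>(t\<^sub>x)W\<close>, is Hermitian
  and commutes with \<open>\<rho>\<close>.  Its blocks intertwine the irreducible constituents, so Schur's lemma kills
  the off-diagonal ones.  Over \<open>\<real>\<close> the commutant of an irreducible representation may be larger
  than the scalars, but a Hermitian intertwiner has a real eigenvalue, and the corresponding
  eigenspace is invariant; hence the diagonal blocks are scalar.  Comparing traces, the weights
  \<open>sqrt (d\<^sub>i / d)\<close> make all these scalars equal to \<open>|X| r / d\<close>.

  The group permutes the subspaces by unitaries, and both the chordal distance and the isoclinic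
  relation are symmetric and unitarily invariant; under double homogeneity a single pair of distinct
  points therefore determines all of them.
\<close>

section \<open>Scalars\<close>

text \<open>An r-dimensional subspace has many isometries onto it, and the one attached to x is in
  general not carried by g to the one attached to \<open>\<sigma> g x\<close>. Identities between
  subspaces are therefore passed through the orthogonal projection, which is unique: this makes the
  frame operator exactly invariant under conjugation and the chordal distance independent of the
  chosen isometries. Adjoints let both scalar fields be treated alike. For an intertwiner T between
  irreducible representations, the two products of T with its adjoint are Hermitian, hence scalar
  over the reals as well, and comparing these scalars replaces any discussion of division algebras,
  kernels and ranges. Block arithmetic uses the coordinate maps E_i of the direct sum. The relations
  E_i \<rho>(g) = \<rho>_i(g) E_i and E_i \<Psi> = c_i \<Psi>_i, with c_i = sqrt (d_i/d), turn
  statements about the big matrices into short algebra. Each of the |X| summands of diagonal block i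
  is c_i^2 times a projection of rank r, so the trace is proportional to the block size d_i.\<close>

lemma conjugate_one [simp]: "conjugate (1 :: 'a::conjugatable_field) = 1"
proof -
  have "conjugate (1::'a) * conjugate 1 = conjugate 1"
    by (simp flip: conjugate_dist_mul)
  then show ?thesis by simp
qed

lemma to_complex_zero [simp]: "to_complex (0 :: 'a::real_or_complex) = 0"
  using to_complex_add[of "0::'a" 0] by simp

lemma to_complex_one [simp]: "to_complex (1 :: 'a::real_or_complex) = 1"
proof -
  have "to_complex (1::'a) * to_complex (1::'a) = to_complex (1::'a)"
    by (simp only: mult_1_left to_complex_mult[symmetric])
  moreover have "to_complex (1::'a) \<noteq> 0"
    using norm_to_complex[of "1::'a"] by auto
  ultimately show ?thesis by simp
qed

lemma to_complex_of_real [simp]: "to_complex (of_real c :: 'a::real_or_complex) = of_real c"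
  by (simp add: of_real_def to_complex_scaleR)

text \<open>Provides the transfer of characteristic polynomials and their values along the
  embedding, by which eigenvalues found over the complex numbers are brought back to the given
  field.\<close>

interpretation to_complex_hom: inj_comm_ring_hom "to_complex :: 'a::real_or_complex \<Rightarrow> complex"
proof
  fix x :: 'a
  assume "to_complex x = 0"
  then show "x = 0" using norm_to_complex[of x] by simp
qed (simp_all add: to_complex_add to_complex_mult)

lemma conjugate_of_real [simp]: "conjugate (of_real c :: 'a::real_or_complex) = of_real c"
  by (rule injD[OF inj_to_complex]) (simp add: to_complex_conjugate)

text \<open>Known for complex numbers, and pulled back along the injective, isometric,
  conjugation-preserving embedding. All positivity arguments for the abstract field rest on
  it.\<close>

lemma conjugate_mult_self:
  "conjugate a * a = (of_real ((norm a)\<^sup>2) :: 'a::real_or_complex)"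
proof (rule injD[OF inj_to_complex])
  show "to_complex (conjugate a * a) = to_complex (of_real ((norm a)\<^sup>2) :: 'a)"
    using complex_norm_square[of "to_complex a"]
    unfolding to_complex_of_real to_complex_mult to_complex_conjugate norm_to_complex
    by (simp add: mult.commute)
qed

lemma norm_conjugate [simp]: "norm (conjugate (a::'a::real_or_complex)) = norm a"
proof -
  have "norm (conjugate a) = cmod (to_complex (conjugate a))" by (simp only: norm_to_complex)
  then show ?thesis by (simp add: to_complex_conjugate norm_to_complex)
qed

section \<open>Adjoints\<close>

lemma dim_mat_adjoint [simp]:
  "dim_row (mat_adjoint A) = dim_col A" "dim_col (mat_adjoint A) = dim_row A"
  by (auto simp: mat_adjoint_def)

lemma mat_adjoint_carrier [simp]: "A \<in> carrier_mat m n \<Longrightarrow> mat_adjoint A \<in> carrier_mat n m"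
  by (rule carrier_matI) (simp_all add: carrier_matD)

lemma index_mat_adjoint [simp]:
  "i < dim_col A \<Longrightarrow> j < dim_row A \<Longrightarrow> mat_adjoint A $$ (i, j) = conjugate (A $$ (j, i))"
  by (simp add: mat_adjoint_def mat_of_rows_index)

lemma mat_adjoint_adjoint [simp]: "mat_adjoint (mat_adjoint A) = A"
  by (rule eq_matI) auto

lemma mult_index:
  "i < dim_row A \<Longrightarrow> j < dim_col B \<Longrightarrow> dim_col A = dim_row B \<Longrightarrow>
    (A * B) $$ (i, j) = (\<Sum>k<dim_row B. A $$ (i, k) * B $$ (k, j))"
  by (simp add: scalar_prod_def atLeast0LessThan)

lemma mat_adjoint_mult:
  "dim_col A = dim_row B \<Longrightarrow> mat_adjoint (A * B) = mat_adjoint B * mat_adjoint A"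
  by (rule eq_matI)
    (auto simp: mult_index sum_conjugate conjugate_dist_mul mult.commute simp del: index_mult_mat(1))

lemma mat_adjoint_smult: "mat_adjoint (c \<cdot>\<^sub>m A) = conjugate c \<cdot>\<^sub>m mat_adjoint A"
  by (rule eq_matI) (auto simp: conjugate_dist_mul)

text \<open>Bare dimension equations as side conditions, instead of carrier membership, let the
  simplifier reassociate long products once the dimension facts are simp rules.\<close>

lemma mult_assoc_dim:
  fixes A B C :: "'a::semiring_0 mat"
  shows "dim_col A = dim_row B \<Longrightarrow> dim_col B = dim_row C \<Longrightarrow> (A * B) * C = A * (B * C)"
  by (rule assoc_mult_mat[of A "dim_row A" "dim_row B" B "dim_row C" C "dim_col C"]) auto

lemma mult_smult_dim:
  fixes A B :: "'a::comm_semiring_0 mat"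
  assumes "dim_col A = dim_row B"
  shows "(c \<cdot>\<^sub>m A) * B = c \<cdot>\<^sub>m (A * B)" "A * (c \<cdot>\<^sub>m B) = c \<cdot>\<^sub>m (A * B)"
proof -
  have A: "A \<in> carrier_mat (dim_row A) (dim_row B)" and B: "B \<in> carrier_mat (dim_row B) (dim_col B)"
    using assms by (auto intro: carrier_matI)
  show "(c \<cdot>\<^sub>m A) * B = c \<cdot>\<^sub>m (A * B)" by (rule mult_smult_assoc_mat[OF A B])
  show "A * (c \<cdot>\<^sub>m B) = c \<cdot>\<^sub>m (A * B)" by (rule mult_smult_distrib[OF A B])
qed

section \<open>Traces and the Frobenius norm\<close>

definition mat_tr :: "'a::comm_monoid_add mat \<Rightarrow> 'a" where
  "mat_tr A = (\<Sum>i<dim_row A. A $$ (i, i))"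

lemma mat_tr_comm:
  fixes A B :: "'a::comm_semiring_0 mat"
  assumes "dim_col A = dim_row B" "dim_col B = dim_row A"
  shows "mat_tr (A * B) = mat_tr (B * A)"
proof -
  have "mat_tr (A * B) = (\<Sum>i<dim_row A. \<Sum>k<dim_row B. A $$ (i, k) * B $$ (k, i))"
    using assms by (simp add: mat_tr_def mult_index del: index_mult_mat(1))
  also have "\<dots> = (\<Sum>k<dim_row B. \<Sum>i<dim_row A. B $$ (k, i) * A $$ (i, k))"
    by (subst sum.swap) (simp add: mult.commute)
  also have "\<dots> = mat_tr (B * A)"
    using assms by (simp add: mat_tr_def mult_index del: index_mult_mat(1))
  finally show ?thesis .
qed

lemma mat_tr_smult_one [simp]: "mat_tr (c \<cdot>\<^sub>m 1\<^sub>m n) = c * (of_nat n :: 'a::comm_semiring_1)"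
  by (simp add: mat_tr_def mult.commute)

text \<open>Writing the Frobenius norm as a trace makes cyclicity available for chordal distances
  and gives definiteness of the Gram matrix.\<close>

lemma mat_tr_adjoint_mult_self:
  fixes M :: "'a::real_or_complex mat"
  shows "mat_tr (mat_adjoint M * M) = of_real ((frobenius_norm M)\<^sup>2)"
proof -
  have "mat_tr (mat_adjoint M * M) =
      (\<Sum>j<dim_col M. \<Sum>i<dim_row M. of_real ((norm (M $$ (i, j)))\<^sup>2))"
    by (simp add: mat_tr_def mult_index conjugate_mult_self del: index_mult_mat(1))
  also have "\<dots> = (\<Sum>i<dim_row M. \<Sum>j<dim_col M. of_real ((norm (M $$ (i, j)))\<^sup>2))"
    by (rule sum.swap)
  also have "\<dots> = of_real ((frobenius_norm M)\<^sup>2)"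
    by (simp add: frobenius_norm_def sum_nonneg)
  finally show ?thesis .
qed

text \<open>The trace of the Gram matrix is the sum of the squared norms of all entries, so its
  vanishing kills every entry.\<close>

lemma adjoint_mult_self_eq_zero:
  fixes M :: "'a::real_or_complex mat"
  assumes M: "M \<in> carrier_mat m n" and "mat_adjoint M * M = 0\<^sub>m n n"
  shows "M = 0\<^sub>m m n"
proof -
  have "mat_tr (mat_adjoint M * M) = 0"
    using assms(2) by (simp add: mat_tr_def)
  then have "frobenius_norm M = 0"
    by (simp add: mat_tr_adjoint_mult_self)
  then have "\<forall>i<m. \<forall>j<n. norm (M $$ (i, j)) = 0"
    using M by (auto simp: frobenius_norm_def sum_nonneg_eq_0_iff sum_nonneg)
  then show ?thesis
    using M by (intro eq_matI) auto
qed

lemma frobenius_norm_adjoint: "frobenius_norm (mat_adjoint M) = frobenius_norm (M :: 'a::real_or_complex mat)"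
proof -
  have "(\<Sum>i<dim_row M. \<Sum>j<dim_col M. (norm (M $$ (i, j)))\<^sup>2) =
      (\<Sum>j<dim_col M. \<Sum>i<dim_row M. (norm (M $$ (i, j)))\<^sup>2)"
    by (rule sum.swap)
  then show ?thesis by (simp add: frobenius_norm_def)
qed

lemma eq_mat_on_vecI:
  fixes A B :: "'a::semiring_1 mat"
  assumes A: "A \<in> carrier_mat m n" and B: "B \<in> carrier_mat m n"
    and eq: "\<And>v. v \<in> carrier_vec n \<Longrightarrow> A *\<^sub>v v = B *\<^sub>v v"
  shows "A = B"
proof (rule eq_matI)
  fix i j assume ij: "i < dim_row B" "j < dim_col B"
  have "(A *\<^sub>v unit_vec n j) $ i = (B *\<^sub>v unit_vec n j) $ i"
    using eq by simp
  then show "A $$ (i, j) = B $$ (i, j)"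
    using A B ij by (auto simp: row_def)
qed (use A B in auto)

section \<open>Subspaces\<close>

lemma is_subspaceI:
  fixes W :: "'a::field vec set"
  assumes "W \<subseteq> carrier_vec d" "0\<^sub>v d \<in> W"
    and "\<And>v w. v \<in> W \<Longrightarrow> w \<in> W \<Longrightarrow> v + w \<in> W" "\<And>c v. v \<in> W \<Longrightarrow> c \<cdot>\<^sub>v v \<in> W"
  shows "is_subspace d W"
  unfolding VectorSpace.subspace_def submodule_def
  using assms vec_vs vec_module by (auto simp: module_vec_simps class_ring_simps)

lemma mat_image_subspace:
  fixes \<Phi> :: "'a::field mat"
  assumes "\<Phi> \<in> carrier_mat d r"
  shows "is_subspace d (mat_image \<Phi>)"
proof (rule is_subspaceI)
  show "0\<^sub>v d \<in> mat_image \<Phi>"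
    using assms unfolding mat_image_def by (intro image_eqI[of _ _ "0\<^sub>v r"]) auto
next
  fix v w assume "v \<in> mat_image \<Phi>" "w \<in> mat_image \<Phi>"
  then obtain a b where "a \<in> carrier_vec r" "b \<in> carrier_vec r" "v = \<Phi> *\<^sub>v a" "w = \<Phi> *\<^sub>v b"
    using assms by (auto simp: mat_image_def)
  then show "v + w \<in> mat_image \<Phi>"
    using assms unfolding mat_image_def
    by (intro image_eqI[of _ _ "a + b"]) (auto simp: mult_add_distrib_mat_vec)
next
  fix c v assume "v \<in> mat_image \<Phi>"
  then obtain a where "a \<in> carrier_vec r" "v = \<Phi> *\<^sub>v a"
    using assms by (auto simp: mat_image_def)
  then show "c \<cdot>\<^sub>v v \<in> mat_image \<Phi>"
    using assms unfolding mat_image_def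
    by (intro image_eqI[of _ _ "c \<cdot>\<^sub>v a"]) (auto simp: mult_mat_vec)
qed (use assms in \<open>auto simp: mat_image_def\<close>)

text \<open>The image, taken as a vector space of its own, is the target of a linear bijection from
  the full coordinate space of dimension r.\<close>

lemma subspace_dim_mat_image:
  fixes \<Phi> :: "'a::field mat"
  assumes \<Phi>: "\<Phi> \<in> carrier_mat d r" and inj: "inj_on (\<lambda>v. \<Phi> *\<^sub>v v) (carrier_vec r)"
  shows "subspace_dim d (mat_image \<Phi>) = r"
proof -
  interpret V: vec_space "TYPE('a)" r .
  let ?W = "(module_vec TYPE('a) d)\<lparr>carrier := mat_image \<Phi>\<rparr>"
  have W: "vectorspace class_ring ?W"
    using vectorspace.subspace_is_vs[OF vec_vs mat_image_subspace[OF \<Phi>]] by simp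
  have "linear_map class_ring (module_vec TYPE('a) r) ?W (\<lambda>v. \<Phi> *\<^sub>v v)"
    unfolding linear_map_def mod_hom_def mod_hom_axioms_def LinearCombinations.module_hom_def
    using W vec_vs[where 'a='a and n=r] \<Phi>
    by (auto simp: vectorspace_def module_vec_simps class_ring_simps mat_image_def
        mult_add_distrib_mat_vec mult_mat_vec)
  from linear_map.dim_eq[OF this] have "V.dim = vectorspace.dim class_ring ?W"
    using inj V.fin_dim \<Phi> by (auto simp: module_vec_simps mat_image_def)
  then show ?thesis
    by (simp add: subspace_dim_def V.dim_is_n)
qed

section \<open>Isometries and orthogonal projections\<close>

lemma isometry_mult_vec:
  assumes "is_isometry d r \<Phi>" "v \<in> carrier_vec r"
  shows "mat_adjoint \<Phi> *\<^sub>v (\<Phi> *\<^sub>v v) = v"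
proof -
  have "mat_adjoint \<Phi> *\<^sub>v (\<Phi> *\<^sub>v v) = (mat_adjoint \<Phi> * \<Phi>) *\<^sub>v v"
    using assms by (intro assoc_mult_mat_vec[symmetric, of _ r d _ r]) (auto simp: is_isometry_def)
  then show ?thesis using assms by (simp add: is_isometry_def)
qed

lemma subspace_dim_isometry:
  assumes "isometry_onto d r \<Phi> W"
  shows "is_subspace d W" "subspace_dim d W = r"
proof -
  have iso: "is_isometry d r \<Phi>" and im: "mat_image \<Phi> = W" and c: "\<Phi> \<in> carrier_mat d r"
    using assms by (auto simp: isometry_onto_def is_isometry_def)
  show "is_subspace d W" using mat_image_subspace[OF c] im by simp
  have "inj_on (\<lambda>v. \<Phi> *\<^sub>v v) (carrier_vec r)"
    by (rule inj_on_inverseI[of _ "\<lambda>v. mat_adjoint \<Phi> *\<^sub>v v"]) (rule isometry_mult_vec[OF iso])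
  then show "subspace_dim d W = r" using subspace_dim_mat_image[OF c] im by simp
qed

text \<open>In the square of the product the inner factors
  \<open>mat_adjoint \<Phi> * \<Phi>\<close> cancel, and the same cancellation shows that every
  vector \<open>\<Phi> *\<^sub>v v\<close> is fixed, so nothing of the image is lost.\<close>

lemma orth_projection_isometry:
  assumes "isometry_onto d r \<Phi> W"
  shows "orth_projection d (\<Phi> * mat_adjoint \<Phi>) W"
proof -
  have iso: "is_isometry d r \<Phi>" and im: "mat_image \<Phi> = W" and c: "\<Phi> \<in> carrier_mat d r"
    and one: "mat_adjoint \<Phi> * \<Phi> = 1\<^sub>m r"
    using assms by (auto simp: isometry_onto_def is_isometry_def)
  note dims [simp] = carrier_matD[OF c]
  have "\<Phi> * mat_adjoint \<Phi> * (\<Phi> * mat_adjoint \<Phi>) = \<Phi> * ((mat_adjoint \<Phi> * \<Phi>) * mat_adjoint \<Phi>)"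
    by (simp add: mult_assoc_dim)
  also have "\<dots> = \<Phi> * mat_adjoint \<Phi>"
    using c by (simp add: one)
  finally have idem: "\<Phi> * mat_adjoint \<Phi> * (\<Phi> * mat_adjoint \<Phi>) = \<Phi> * mat_adjoint \<Phi>" .
  have act: "(\<Phi> * mat_adjoint \<Phi>) *\<^sub>v v = \<Phi> *\<^sub>v (mat_adjoint \<Phi> *\<^sub>v v)" if "v \<in> carrier_vec d" for v
    using c that by (intro assoc_mult_mat_vec[of _ d r _ d]) auto
  have "mat_image (\<Phi> * mat_adjoint \<Phi>) = mat_image \<Phi>"
  proof (intro subset_antisym subsetI)
    fix w assume "w \<in> mat_image (\<Phi> * mat_adjoint \<Phi>)"
    then obtain v where v: "v \<in> carrier_vec d" "w = \<Phi> *\<^sub>v (mat_adjoint \<Phi> *\<^sub>v v)"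
      by (auto simp: mat_image_def act)
    then show "w \<in> mat_image \<Phi>"
      using mult_mat_vec_carrier[OF mat_adjoint_carrier[OF c] v(1)] by (auto simp: mat_image_def)
  next
    fix w assume "w \<in> mat_image \<Phi>"
    then obtain v where v: "v \<in> carrier_vec r" "w = \<Phi> *\<^sub>v v"
      by (auto simp: mat_image_def)
    then have "w = (\<Phi> * mat_adjoint \<Phi>) *\<^sub>v w" and "w \<in> carrier_vec d"
      using c by (auto simp: act isometry_mult_vec[OF iso])
    then show "w \<in> mat_image (\<Phi> * mat_adjoint \<Phi>)"
      by (auto simp: mat_image_def)
  qed
  then show ?thesis
    using c idem im by (auto simp: orth_projection_def mat_adjoint_mult)
qed

text \<open>The range of Q is the range of P, and an idempotent acts as the identity on its own
  range.\<close>

lemma orth_projection_mult: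
  assumes P: "orth_projection d P W" and Q: "orth_projection d Q W"
  shows "P * Q = Q"
proof (rule eq_mat_on_vecI)
  have cP: "P \<in> carrier_mat d d" and cQ: "Q \<in> carrier_mat d d" and PP: "P * P = P"
    and im: "mat_image Q = mat_image P"
    using P Q unfolding orth_projection_def by simp_all
  show "P * Q \<in> carrier_mat d d" "Q \<in> carrier_mat d d" using cP cQ by auto
  fix v :: "'a vec" assume v: "v \<in> carrier_vec d"
  then have "Q *\<^sub>v v \<in> mat_image Q" using cQ by (auto simp: mat_image_def)
  then obtain u where u: "u \<in> carrier_vec d" "Q *\<^sub>v v = P *\<^sub>v u"
    unfolding im using cP by (auto simp: mat_image_def)
  have "(P * Q) *\<^sub>v v = P *\<^sub>v (P *\<^sub>v u)"
    using assoc_mult_mat_vec[OF cP cQ v] u(2) by simp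
  also have "\<dots> = (P * P) *\<^sub>v u"
    by (rule assoc_mult_mat_vec[symmetric, OF cP cP u(1)])
  finally show "(P * Q) *\<^sub>v v = Q *\<^sub>v v" by (simp only: PP u(2))
qed

text \<open>Both PQ = Q and QP = P hold; taking the adjoint of the first, with P and Q self-adjoint,
  gives QP = Q. This makes the projection a canonical invariant of the subspace.\<close>

lemma orth_projection_unique:
  assumes P: "orth_projection d P W" and Q: "orth_projection d Q W"
  shows "P = Q"
proof -
  have "P = Q * P" by (rule orth_projection_mult[OF Q P, symmetric])
  also have "\<dots> = mat_adjoint (P * Q)"
    using P Q unfolding orth_projection_def by (auto simp: mat_adjoint_mult)
  also have "\<dots> = Q"
    unfolding orth_projection_mult[OF P Q] using Q by (simp add: orth_projection_def)
  finally show ?thesis .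
qed

section \<open>Schur's lemma for Hermitian intertwiners\<close>

text \<open>Over the reals a characteristic polynomial need not have a root. A root is found after
  embedding the entries into the complex numbers; the Hermitian condition makes it real, so it
  descends to either field.\<close>

lemma hermitian_eigenvalue:
  fixes A :: "'a::real_or_complex mat"
  assumes A: "A \<in> carrier_mat d d" and herm: "mat_adjoint A = A" and d: "d > 0"
  shows "\<exists>c. eigenvalue A c"
proof -
  define B where "B = map_mat to_complex A"
  have B: "B \<in> carrier_mat d d" using A by (simp add: B_def)
  have hermB: "mat_adjoint B = B"
  proof (rule eq_matI)
    fix i j assume "i < dim_row B" "j < dim_col B"
    then show "mat_adjoint B $$ (i, j) = B $$ (i, j)"
      using A index_mat_adjoint[of i A j] herm
      by (simp add: B_def flip: to_complex_conjugate)
  qed (use B in auto)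
  obtain k where "eigenvalue B k"
    using spectrum_non_empty[OF B d] by (auto simp: spectrum_def)
  then obtain v where v: "v \<in> carrier_vec d" "v \<noteq> 0\<^sub>v d" "B *\<^sub>v v = k \<cdot>\<^sub>v v"
    using B by (auto simp: eigenvalue_def eigenvector_def)
  \<comment> \<open>The eigenvector is recast as a matrix with one column, so that the adjoint
    calculus for matrices replaces inner products.\<close>
  define V where "V = mat_of_cols d [v]"
  have V: "V \<in> carrier_mat d 1" and colV: "col V 0 = v"
    using v by (auto simp: V_def)
  note dims [simp] = carrier_matD[OF V] carrier_matD[OF B]
  have BV: "B * V = k \<cdot>\<^sub>m V"
  proof (rule eq_matI)
    fix i j assume ij: "i < dim_row (k \<cdot>\<^sub>m V)" "j < dim_col (k \<cdot>\<^sub>m V)"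
    have "(B * V) $$ (i, j) = (B *\<^sub>v v) $ i" using ij colV by simp
    also have "\<dots> = (k \<cdot>\<^sub>m V) $$ (i, j)" using ij v by (simp add: V_def mat_of_cols_index)
    finally show "(B * V) $$ (i, j) = (k \<cdot>\<^sub>m V) $$ (i, j)" .
  qed auto
  \<comment> \<open>The quadratic form of B at the eigenvector is evaluated twice, with B acting to
    the right and, being Hermitian, to the left. The 1 by 1 matrix \<open>mat_adjoint V * V\<close>
    is nonzero, so k equals its conjugate.\<close>
  have "k \<cdot>\<^sub>m (mat_adjoint V * V) = mat_adjoint V * (B * V)"
    by (simp add: BV mult_smult_dim)
  also have "\<dots> = mat_adjoint (B * V) * V"
    by (simp add: mat_adjoint_mult hermB mult_assoc_dim)
  also have "\<dots> = cnj k \<cdot>\<^sub>m (mat_adjoint V * V)"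
    by (simp add: BV mat_adjoint_smult mult_smult_dim)
  finally have eq: "k \<cdot>\<^sub>m (mat_adjoint V * V) = cnj k \<cdot>\<^sub>m (mat_adjoint V * V)" .
  have "V \<noteq> 0\<^sub>m d 1"
  proof
    assume "V = 0\<^sub>m d 1"
    then have "v = col (0\<^sub>m d 1) 0" using colV by simp
    then show False using v by simp
  qed
  then have "mat_adjoint V * V \<noteq> 0\<^sub>m 1 1"
    using adjoint_mult_self_eq_zero[OF V] by blast
  then have "(mat_adjoint V * V) $$ (0, 0) \<noteq> 0"
    by (metis (no_types, lifting) dims(2) dim_mat_adjoint(1) eq_matI index_mult_mat(2,3) index_zero_mat less_one)
  moreover have "k * (mat_adjoint V * V) $$ (0, 0) = cnj k * (mat_adjoint V * V) $$ (0, 0)"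
    using arg_cong[OF eq, of "\<lambda>M. M $$ (0, 0)"] by (simp del: index_mult_mat(1))
  ultimately have "k = cnj k" by simp
  \<comment> \<open>A real number lies in the range of the embedding whichever of the two fields is
    given.\<close>
  then have k: "k = to_complex (of_real (Re k) :: 'a)"
    by (simp add: complex_eq_iff)
  have "poly (char_poly B) (to_complex (of_real (Re k) :: 'a)) = 0"
    using \<open>eigenvalue B k\<close> k by (simp add: eigenvalue_root_char_poly[OF B])
  then have "to_complex (poly (char_poly A) (of_real (Re k))) = 0"
    unfolding B_def by (simp only: to_complex_hom.char_poly_hom[OF A] to_complex_hom.poly_map_poly)
  then have "poly (char_poly A) (of_real (Re k)) = 0" by (rule to_complex_hom.hom_0)
  then show ?thesis unfolding eigenvalue_root_char_poly[OF A, symmetric] by blast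
qed

lemma hermitian_intertwiner_scalar:
  fixes A :: "'a::real_or_complex mat"
  assumes irr: "irreducible_rep G d \<rho>" and A: "A \<in> carrier_mat d d" and herm: "mat_adjoint A = A"
    and \<rho>: "\<And>g. g \<in> carrier G \<Longrightarrow> \<rho> g \<in> carrier_mat d d"
    and comm: "\<And>g. g \<in> carrier G \<Longrightarrow> A * \<rho> g = \<rho> g * A"
  shows "\<exists>c. A = c \<cdot>\<^sub>m 1\<^sub>m d"
proof -
  have "d > 0" using irr by (simp add: irreducible_rep_def)
  from hermitian_eigenvalue[OF A herm this] obtain c v where
    v: "v \<in> carrier_vec d" "v \<noteq> 0\<^sub>v d" "A *\<^sub>v v = c \<cdot>\<^sub>v v"
    using A by (auto simp: eigenvalue_def eigenvector_def)
  define S where "S = {v \<in> carrier_vec d. A *\<^sub>v v = c \<cdot>\<^sub>v v}"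
  have "is_subspace d S"
  proof (rule is_subspaceI)
    show "0\<^sub>v d \<in> S" using A by (auto simp: S_def)
    show "v + w \<in> S" if "v \<in> S" "w \<in> S" for v w
      using that A
      by (auto simp: S_def mult_add_distrib_mat_vec[OF A] smult_add_distrib_vec[of _ d])
    show "a \<cdot>\<^sub>v v \<in> S" if "v \<in> S" for a v
      using that A by (auto simp: S_def mult_mat_vec[OF A] smult_smult_assoc mult.commute)
  qed (auto simp: S_def)
  moreover have "\<rho> g *\<^sub>v w \<in> S" if g: "g \<in> carrier G" and w: "w \<in> S" for g w
  proof -
    have w': "w \<in> carrier_vec d" "A *\<^sub>v w = c \<cdot>\<^sub>v w" using w by (auto simp: S_def)
    have "A *\<^sub>v (\<rho> g *\<^sub>v w) = (A * \<rho> g) *\<^sub>v w"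
      using assoc_mult_mat_vec[OF A \<rho>[OF g] w'(1)] by simp
    also have "\<dots> = \<rho> g *\<^sub>v (A *\<^sub>v w)"
      using assoc_mult_mat_vec[OF \<rho>[OF g] A w'(1)] comm[OF g] by simp
    also have "\<dots> = c \<cdot>\<^sub>v (\<rho> g *\<^sub>v w)"
      using mult_mat_vec[OF \<rho>[OF g] w'(1)] w'(2) by simp
    finally show ?thesis
      using mult_mat_vec_carrier[OF \<rho>[OF g] w'(1)] by (simp add: S_def)
  qed
  ultimately have "S = {0\<^sub>v d} \<or> S = carrier_vec d"
    using irr unfolding irreducible_rep_def by blast
  moreover have "v \<in> S" using v by (simp add: S_def)
  ultimately have S: "S = carrier_vec d" using v by blast
  have "A = c \<cdot>\<^sub>m 1\<^sub>m d"
  proof (rule eq_mat_on_vecI[OF A])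
    show "c \<cdot>\<^sub>m 1\<^sub>m d \<in> carrier_mat d d" by simp
    fix w :: "'a vec" assume w: "w \<in> carrier_vec d"
    have "(c \<cdot>\<^sub>m 1\<^sub>m d) *\<^sub>v w = c \<cdot>\<^sub>v w"
      using w by (intro eq_vecI) auto
    then show "A *\<^sub>v w = (c \<cdot>\<^sub>m 1\<^sub>m d) *\<^sub>v w" using w S by (auto simp: S_def)
  qed
  then show ?thesis by blast
qed

section \<open>Intertwiners between unitary representations\<close>

lemma unitary_groupD:
  assumes "U \<in> carrier (unitary_group d)"
  shows "U \<in> carrier_mat d d" "dim_row U = d" "dim_col U = d"
    "mat_adjoint U * U = 1\<^sub>m d" "U * mat_adjoint U = 1\<^sub>m d"
  using assms by (auto simp: unitary_group_def)

text \<open>Inserting \<open>U * mat_adjoint U\<close> on the left turns the product into U times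
  the adjoint of \<open>T * U\<close>; replacing this by the adjoint of \<open>U' * T\<close> lets
  U' cancel. It is applied to intertwiners and also to the block selectors.\<close>

lemma adjoint_intertwines:
  assumes U: "U \<in> carrier (unitary_group m)" and U': "U' \<in> carrier (unitary_group n)"
    and T: "T \<in> carrier_mat n m" and eq: "T * U = U' * T"
  shows "mat_adjoint T * U' = U * mat_adjoint T"
proof -
  note [simp] = unitary_groupD(2,3)[OF U] unitary_groupD(2,3)[OF U'] carrier_matD[OF T]
  have "mat_adjoint T * U' = (U * mat_adjoint U) * mat_adjoint T * U'"
    using T by (simp add: unitary_groupD(5)[OF U] left_mult_one_mat[OF mat_adjoint_carrier])
  also have "\<dots> = U * (mat_adjoint (T * U) * U')"
    by (simp add: mult_assoc_dim mat_adjoint_mult)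
  also have "\<dots> = U * (mat_adjoint T * (mat_adjoint U' * U'))"
    by (simp add: mult_assoc_dim mat_adjoint_mult eq)
  also have "\<dots> = U * mat_adjoint T"
    using T by (simp add: unitary_groupD(4)[OF U'] right_mult_one_mat[OF mat_adjoint_carrier])
  finally show ?thesis .
qed

text \<open>The products of T with its adjoint in both orders commute with the irreducible
  representations and are Hermitian, hence scalars a and b. A nonzero T forces a = b, nonzero by
  definiteness, and then the rescaled adjoint inverts T, contradicting inequivalence.\<close>

lemma intertwiner_zero:
  fixes T :: "'a::real_or_complex mat"
  assumes \<rho>: "\<rho> \<in> hom G (unitary_group m)" "irreducible_rep G m \<rho>"
    and \<rho>': "\<rho>' \<in> hom G (unitary_group n)" "irreducible_rep G n \<rho>'"
    and neq: "\<not> equivalent_reps G m \<rho> n \<rho>'"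
    and T: "T \<in> carrier_mat n m" and eq: "\<And>g. g \<in> carrier G \<Longrightarrow> T * \<rho> g = \<rho>' g * T"
  shows "T = 0\<^sub>m n m"
proof (rule ccontr)
  assume nz: "T \<noteq> 0\<^sub>m n m"
  note [simp] = carrier_matD[OF T]
  have u: "\<rho> g \<in> carrier (unitary_group m)" "\<rho>' g \<in> carrier (unitary_group n)"
    if "g \<in> carrier G" for g
    using \<rho>(1) \<rho>'(1) that by (auto simp: hom_def)
  note dims = unitary_groupD(2,3)[OF u(1)] unitary_groupD(2,3)[OF u(2)]
  note eq' = adjoint_intertwines[OF u T eq]
  obtain a where a: "mat_adjoint T * T = a \<cdot>\<^sub>m 1\<^sub>m m"
  proof -
    have "mat_adjoint T * T * \<rho> g = \<rho> g * (mat_adjoint T * T)" if g: "g \<in> carrier G" for g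
    proof -
      have "mat_adjoint T * T * \<rho> g = (mat_adjoint T * \<rho>' g) * T"
        by (simp add: mult_assoc_dim dims g eq)
      also have "\<dots> = \<rho> g * (mat_adjoint T * T)"
        by (simp add: mult_assoc_dim dims g eq')
      finally show ?thesis .
    qed
    then show ?thesis
      using hermitian_intertwiner_scalar[OF \<rho>(2) _ _ unitary_groupD(1)[OF u(1)]] that T
      by (metis mat_adjoint_adjoint mat_adjoint_carrier mat_adjoint_mult mult_carrier_mat dim_mat_adjoint)
  qed
  obtain b where b: "T * mat_adjoint T = b \<cdot>\<^sub>m 1\<^sub>m n"
  proof -
    have "T * mat_adjoint T * \<rho>' g = \<rho>' g * (T * mat_adjoint T)" if g: "g \<in> carrier G" for g
    proof -
      have "T * mat_adjoint T * \<rho>' g = (T * \<rho> g) * mat_adjoint T"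
        by (simp add: mult_assoc_dim dims g eq')
      also have "\<dots> = \<rho>' g * (T * mat_adjoint T)"
        by (simp add: mult_assoc_dim dims g eq)
      finally show ?thesis .
    qed
    then show ?thesis
      using hermitian_intertwiner_scalar[OF \<rho>'(2) _ _ unitary_groupD(1)[OF u(2)]] that T
      by (metis mat_adjoint_adjoint mat_adjoint_carrier mat_adjoint_mult mult_carrier_mat dim_mat_adjoint)
  qed
  have a0: "a \<noteq> 0"
  proof
    assume "a = 0"
    then have "mat_adjoint T * T = 0\<^sub>m m m" unfolding a by (intro eq_matI) auto
    then show False using adjoint_mult_self_eq_zero[OF T] nz by blast
  qed
  \<comment> \<open>Bracketing the triple product of T, its adjoint and T in the two possible ways
    compares the scalars; any nonzero entry of T then gives b = a.\<close>
  have "a \<cdot>\<^sub>m T = T * (mat_adjoint T * T)"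
    unfolding a using T by (simp add: mult_smult_dim)
  also have "\<dots> = (T * mat_adjoint T) * T" by (simp add: mult_assoc_dim)
  also have "\<dots> = b \<cdot>\<^sub>m T"
    unfolding b using T by (simp add: mult_smult_dim)
  finally have ab: "a \<cdot>\<^sub>m T = b \<cdot>\<^sub>m T" .
  obtain i j where ij: "i < n" "j < m" "T $$ (i, j) \<noteq> 0"
  proof -
    have "\<exists>i<n. \<exists>j<m. T $$ (i, j) \<noteq> 0"
    proof (rule ccontr)
      assume "\<not> ?thesis"
      then have "T = 0\<^sub>m n m" using T by (intro eq_matI) auto
      with nz show False by simp
    qed
    then show ?thesis using that by blast
  qed
  have "a * T $$ (i, j) = b * T $$ (i, j)"
    using arg_cong[OF ab, of "\<lambda>M. M $$ (i, j)"] ij by simp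
  then have ba: "b = a" using ij by simp
  \<comment> \<open>Cyclicity of the trace compares the sizes: in characteristic zero a common
    nonzero scalar forces m = n, so T is square.\<close>
  have "a * of_nat m = b * of_nat n"
    using mat_tr_comm[of "mat_adjoint T" T] by (simp add: a b)
  then have mn: "m = n" using a0 ba by simp
  have "T * (inverse a \<cdot>\<^sub>m mat_adjoint T) = 1\<^sub>m n" "(inverse a \<cdot>\<^sub>m mat_adjoint T) * T = 1\<^sub>m m"
    using a0 by (auto simp: mult_smult_dim a b ba intro!: eq_matI)
  then have "invertible_mat T"
    unfolding invertible_mat_def inverts_mat_def using mn
    by (auto intro!: exI[of _ "inverse a \<cdot>\<^sub>m mat_adjoint T"])
  then have "equivalent_reps G m \<rho> n \<rho>'"
    unfolding equivalent_reps_def using T eq by blast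
  with neq show False ..
qed

section \<open>Block decompositions\<close>

text \<open>The coordinate map E_i of a direct sum of l spaces of dimensions n_0, n_1, ... onto its
  i-th summand; left multiplication by it extracts a block of rows.\<close>

definition block_sel :: "(nat \<Rightarrow> nat) \<Rightarrow> nat \<Rightarrow> nat \<Rightarrow> 'a::zero_neq_one mat" where
  "block_sel n l i = mat (n i) (\<Sum>j<l. n j) (\<lambda>(a, b). if b = (\<Sum>j<i. n j) + a then 1 else 0)"

lemma block_offset_less:
  fixes n :: "nat \<Rightarrow> nat"
  assumes "i < l" "a < n i"
  shows "(\<Sum>j<i. n j) + a < (\<Sum>j<l. n j :: nat)"
proof -
  have "(\<Sum>j<i. n j) + a < (\<Sum>j<Suc i. n j)" using assms by simp
  also have "\<dots> \<le> (\<Sum>j<l. n j)" using assms by (intro sum_mono2) auto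
  finally show ?thesis .
qed

lemma block_offset_exists:
  fixes n :: "nat \<Rightarrow> nat"
  assumes "k < (\<Sum>j<l. n j :: nat)"
  shows "\<exists>i<l. \<exists>a<n i. k = (\<Sum>j<i. n j) + a"
  using assms
proof (induction l)
  case (Suc l)
  show ?case
  proof (cases "k < (\<Sum>j<l. n j)")
    case True
    then show ?thesis using Suc.IH less_Suc_eq by blast
  next
    case False
    then show ?thesis using Suc.prems
      by (intro exI[of _ l] conjI exI[of _ "k - (\<Sum>j<l. n j)"]) auto
  qed
qed simp

lemma block_offset_inj:
  fixes n :: "nat \<Rightarrow> nat"
  assumes "a < n i" "b < n j" "(\<Sum>k<i. n k) + a = (\<Sum>k<j. n k :: nat) + b"
  shows "i = j \<and> a = b"
proof -
  have "\<not> i < j" if "a < n i" "(\<Sum>k<i. n k) + a = (\<Sum>k<j. n k) + b" for i j a b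
    using block_offset_less[of i j a n] that by auto
  then have "i = j" using assms by (metis linorder_neqE_nat)
  then show ?thesis using assms by simp
qed

lemma sum_blocks:
  fixes n :: "nat \<Rightarrow> nat"
  shows "(\<Sum>k<(\<Sum>i<l. n i). f k) = (\<Sum>i<l. \<Sum>a<n i. f ((\<Sum>j<i. n j) + a) :: 'a::comm_monoid_add)"
proof (induction l)
  case (Suc l)
  have "(\<Sum>k<m + p. f k) = (\<Sum>k<m. f k) + (\<Sum>a<p. f (m + a))" for m p
    by (induction p) (auto simp: add.assoc)
  then show ?case using Suc by simp
qed simp

lemma block_sel_carrier [simp]: "block_sel n l i \<in> carrier_mat (n i) (\<Sum>j<l. n j)"
  and dim_block_sel [simp]: "dim_row (block_sel n l i) = n i" "dim_col (block_sel n l i) = (\<Sum>j<l. n j)"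
  by (auto simp: block_sel_def)

lemma index_block_sel_mult:
  fixes A :: "'a::semiring_1 mat"
  assumes "i < l" "a < n i" "b < dim_col A" "dim_row A = (\<Sum>j<l. n j)"
  shows "(block_sel n l i * A) $$ (a, b) = A $$ ((\<Sum>j<i. n j) + a, b)"
proof -
  have "(block_sel n l i * A) $$ (a, b) =
      (\<Sum>k<dim_row A. (if k = (\<Sum>j<i. n j) + a then 1 else 0) * A $$ (k, b))"
    using assms by (simp add: mult_index block_sel_def del: index_mult_mat(1))
  also have "\<dots> = (\<Sum>k<dim_row A. if k = (\<Sum>j<i. n j) + a then A $$ (k, b) else 0)"
    by (rule sum.cong) auto
  also have "\<dots> = A $$ ((\<Sum>j<i. n j) + a, b)"
    using block_offset_less[of i l a n, OF assms(1,2)] assms(4) by (simp add: sum.delta)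
  finally show ?thesis .
qed

text \<open>Every row index lies in some block, so the selectors together see every entry. It
  reduces identities of stacked matrices to their blocks.\<close>

lemma block_sel_eqI:
  fixes A B :: "'a::semiring_1 mat"
  assumes A: "A \<in> carrier_mat (\<Sum>j<l. n j) m" and B: "B \<in> carrier_mat (\<Sum>j<l. n j) m"
    and eq: "\<And>i. i < l \<Longrightarrow> block_sel n l i * A = block_sel n l i * B"
  shows "A = B"
proof (rule eq_matI)
  fix k b assume "k < dim_row B" "b < dim_col B"
  then obtain i a where ia: "i < l" "a < n i" "k = (\<Sum>j<i. n j) + a" and b: "b < m"
    using block_offset_exists B by (metis carrier_matD)
  then show "A $$ (k, b) = B $$ (k, b)"
    using arg_cong[OF eq[OF ia(1)], of "\<lambda>M. M $$ (a, b)"] A B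
    by (simp add: index_block_sel_mult del: index_mult_mat(1))
qed (use A B in auto)

lemma block_sel_mult_adjoint:
  assumes "i < l" "j < l"
  shows "block_sel n l i * mat_adjoint (block_sel n l j) =
    (if i = j then 1\<^sub>m (n i) else 0\<^sub>m (n i) (n j) :: 'a::conjugatable_field mat)"
proof (rule eq_matI)
  fix a b
  assume "a < dim_row (if i = j then 1\<^sub>m (n i) else 0\<^sub>m (n i) (n j) :: 'a mat)"
    "b < dim_col (if i = j then 1\<^sub>m (n i) else 0\<^sub>m (n i) (n j) :: 'a mat)"
  then have ab: "a < n i" "b < n j" by (auto split: if_splits)
  then have "(block_sel n l i * mat_adjoint (block_sel n l j)) $$ (a, b)
      = conjugate ((block_sel n l j :: 'a mat) $$ (b, (\<Sum>j<i. n j) + a))"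
    using assms block_offset_less[of i l a n, OF assms(1) ab(1)]
    by (simp add: index_block_sel_mult del: index_mult_mat(1))
  also have "\<dots> = (if i = j \<and> a = b then 1 else 0)"
    using ab block_offset_less[of i l a n, OF assms(1) ab(1)] block_offset_inj[of a n i b j]
    by (auto simp: block_sel_def)
  finally show "(block_sel n l i * mat_adjoint (block_sel n l j)) $$ (a, b) =
      (if i = j then 1\<^sub>m (n i) else 0\<^sub>m (n i) (n j) :: 'a mat) $$ (a, b)"
    using ab by auto
qed auto

text \<open>The one-sided criterion applied twice, the second time to adjoints, where columns become
  rows.\<close>

lemma block_sel_eqI2:
  fixes A B :: "'a::conjugatable_field mat"
  assumes A: "A \<in> carrier_mat (\<Sum>j<l. n j) (\<Sum>j<l. n j)"
    and B: "B \<in> carrier_mat (\<Sum>j<l. n j) (\<Sum>j<l. n j)"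
    and eq: "\<And>i j. i < l \<Longrightarrow> j < l \<Longrightarrow> block_sel n l i * A * mat_adjoint (block_sel n l j) =
      block_sel n l i * B * mat_adjoint (block_sel n l j)"
  shows "A = B"
proof (rule block_sel_eqI[OF A B])
  fix i assume i: "i < l"
  note [simp] = carrier_matD[OF A] carrier_matD[OF B]
  have "mat_adjoint (block_sel n l i * A) = mat_adjoint (block_sel n l i * B)"
  proof (rule block_sel_eqI)
    fix j assume j: "j < l"
    have "mat_adjoint (block_sel n l i * A * mat_adjoint (block_sel n l j))
      = mat_adjoint (block_sel n l i * B * mat_adjoint (block_sel n l j))"
      by (simp only: eq[OF i j])
    then show "block_sel n l j * mat_adjoint (block_sel n l i * A) =
        block_sel n l j * mat_adjoint (block_sel n l i * B)"
      by (simp add: mat_adjoint_mult)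
  qed (auto intro!: carrier_matI)
  then show "block_sel n l i * A = block_sel n l i * B"
    by (metis mat_adjoint_adjoint)
qed

text \<open>The fold exposes the first block, so the induction peels from the front and shifts the
  family by one; this is why A and n are generalized. Dimensions and entries are proved together,
  since locating an entry of the tail uses the dimensions.\<close>

lemma stack_rows_carrier_index:
  fixes A :: "nat \<Rightarrow> 'a::zero mat"
  assumes "\<And>i. i < l \<Longrightarrow> A i \<in> carrier_mat (n i) r"
  shows "stack_rows r (map A [0..<l]) \<in> carrier_mat (\<Sum>j<l. n j) r \<and>
    (\<forall>i<l. \<forall>a<n i. \<forall>b<r. stack_rows r (map A [0..<l]) $$ ((\<Sum>j<i. n j) + a, b) = A i $$ (a, b))"
  using assms
proof (induction l arbitrary: A n)
  case (Suc l)
  define B where "B = stack_rows r (map (\<lambda>i. A (Suc i)) [0..<l])"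
  have IH: "B \<in> carrier_mat (\<Sum>j<l. n (Suc j)) r"
    "\<And>i a b. i < l \<Longrightarrow> a < n (Suc i) \<Longrightarrow> b < r \<Longrightarrow>
      B $$ ((\<Sum>j<i. n (Suc j)) + a, b) = A (Suc i) $$ (a, b)"
    using Suc.IH[of "\<lambda>i. A (Suc i)" "\<lambda>i. n (Suc i)"] Suc.prems by (auto simp: B_def)
  have st: "stack_rows r (map A [0..<Suc l]) = A 0 @\<^sub>r B"
    by (simp add: stack_rows_def B_def map_upt_Suc del: upt_Suc)
  have A0: "A 0 \<in> carrier_mat (n 0) r" using Suc.prems by simp
  have "(A 0 @\<^sub>r B) $$ ((\<Sum>j<i. n j) + a, b) = A i $$ (a, b)"
    if "i < Suc l" "a < n i" "b < r" for i a b
  proof (cases i)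
    case 0
    then show ?thesis using that A0 IH(1) by (simp add: append_rows_def)
  next
    case (Suc k)
    then show ?thesis
      using that A0 IH(1) IH(2)[of k a b] block_offset_less[of k l a "\<lambda>i. n (Suc i)"]
      by (simp add: append_rows_def sum.lessThan_Suc_shift del: sum.lessThan_Suc)
  qed
  then show ?case
    unfolding st using carrier_append_rows[OF A0 IH(1)]
    by (simp add: sum.lessThan_Suc_shift del: sum.lessThan_Suc)
qed (simp add: stack_rows_def)

lemma diag_block_carrier_index:
  fixes A :: "nat \<Rightarrow> 'a::zero mat"
  assumes "\<And>i. i < l \<Longrightarrow> A i \<in> carrier_mat (n i) (n i)"
  shows "diag_block_mat (map A [0..<l]) \<in> carrier_mat (\<Sum>j<l. n j) (\<Sum>j<l. n j) \<and>
    (\<forall>i<l. \<forall>a<n i. \<forall>j<l. \<forall>b<n j.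
       diag_block_mat (map A [0..<l]) $$ ((\<Sum>k<i. n k) + a, (\<Sum>k<j. n k) + b) =
         (if i = j then A i $$ (a, b) else 0))"
  using assms
proof (induction l arbitrary: A n)
  case (Suc l)
  define B where "B = diag_block_mat (map (\<lambda>i. A (Suc i)) [0..<l])"
  have IH: "B \<in> carrier_mat (\<Sum>j<l. n (Suc j)) (\<Sum>j<l. n (Suc j))"
    "\<And>i a j b. i < l \<Longrightarrow> a < n (Suc i) \<Longrightarrow> j < l \<Longrightarrow> b < n (Suc j) \<Longrightarrow>
      B $$ ((\<Sum>k<i. n (Suc k)) + a, (\<Sum>k<j. n (Suc k)) + b) =
        (if i = j then A (Suc i) $$ (a, b) else 0)"
    using Suc.IH[of "\<lambda>i. A (Suc i)" "\<lambda>i. n (Suc i)"] Suc.prems by (auto simp: B_def)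
  have A0: "A 0 \<in> carrier_mat (n 0) (n 0)" using Suc.prems by simp
  have st: "diag_block_mat (map A [0..<Suc l]) =
      four_block_mat (A 0) (0\<^sub>m (n 0) (dim_col B)) (0\<^sub>m (dim_row B) (n 0)) B"
    using A0 by (simp add: B_def map_upt_Suc Let_def del: upt_Suc)
  let ?M = "four_block_mat (A 0) (0\<^sub>m (n 0) (dim_col B)) (0\<^sub>m (dim_row B) (n 0)) B"
  note off = block_offset_less[of _ l _ "\<lambda>i. n (Suc i)"]
  have "?M $$ ((\<Sum>k<i. n k) + a, (\<Sum>k<j. n k) + b) = (if i = j then A i $$ (a, b) else 0)"
    if "i < Suc l" "a < n i" "j < Suc l" "b < n j" for i a j b
    using that A0 IH(1) off IH(2)
    by (cases i; cases j) (auto simp: sum.lessThan_Suc_shift simp del: sum.lessThan_Suc)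
  moreover have "?M \<in> carrier_mat (\<Sum>j<Suc l. n j) (\<Sum>j<Suc l. n j)"
    using A0 IH(1) by (auto simp: sum.lessThan_Suc_shift simp del: sum.lessThan_Suc)
  ultimately show ?case unfolding st by blast
qed simp

lemma block_sel_mult_stack_rows:
  fixes A :: "nat \<Rightarrow> 'a::semiring_1 mat"
  assumes "\<And>i. i < l \<Longrightarrow> A i \<in> carrier_mat (n i) r" "i < l"
  shows "block_sel n l i * stack_rows r (map A [0..<l]) = A i"
proof (rule eq_matI)
  note st = stack_rows_carrier_index[of l A n r, OF assms(1)]
  fix a b assume "a < dim_row (A i)" "b < dim_col (A i)"
  then show "(block_sel n l i * stack_rows r (map A [0..<l])) $$ (a, b) = A i $$ (a, b)"
    using st assms(2) carrier_matD[OF assms(1)[OF assms(2)]]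
    by (subst index_block_sel_mult) auto
qed (use stack_rows_carrier_index[of l A n r, OF assms(1)] carrier_matD[OF assms(1)[OF assms(2)]] in auto)

text \<open>The coordinate map intertwines a direct sum with its i-th summand. This relation carries
  all later reasoning about \<rho>.\<close>

lemma block_sel_mult_diag_block:
  fixes A :: "nat \<Rightarrow> 'a::semiring_1 mat"
  assumes A: "\<And>i. i < l \<Longrightarrow> A i \<in> carrier_mat (n i) (n i)" and i: "i < l"
  shows "block_sel n l i * diag_block_mat (map A [0..<l]) = A i * block_sel n l i"
proof (rule eq_matI)
  let ?D = "diag_block_mat (map A [0..<l])"
  note st = diag_block_carrier_index[of l A n, OF A]
  note Ai = carrier_matD[OF A[OF i]]
  fix a k assume "a < dim_row (A i * block_sel n l i)" "k < dim_col (A i * block_sel n l i)"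
  then have a: "a < n i" and k: "k < (\<Sum>j<l. n j)" using Ai by auto
  obtain j b where jb: "j < l" "b < n j" "k = (\<Sum>m<j. n m) + b"
    using block_offset_exists[OF k] by blast
  have "(block_sel n l i * ?D) $$ (a, k) = (if i = j then A i $$ (a, b) else 0)"
    using st i a k jb by (subst index_block_sel_mult) auto
  \<comment> \<open>The value is expanded into a sum against column k of the i-th selector, which is
    the b-th unit vector when j = i and zero otherwise.\<close>
  also have "\<dots> = (\<Sum>c<n i. A i $$ (a, c) * (if i = j \<and> c = b then 1 else 0))"
    using jb by (auto simp: if_distrib cong: if_cong)
  also have "\<dots> = (\<Sum>c<n i. A i $$ (a, c) * block_sel n l i $$ (c, k))"
    using jb k block_offset_inj[of _ n i b j] by (intro sum.cong) (auto simp: block_sel_def)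
  also have "\<dots> = (A i * block_sel n l i) $$ (a, k)"
    using a k Ai by (simp add: mult_index del: index_mult_mat(1))
  finally show "(block_sel n l i * ?D) $$ (a, k) = (A i * block_sel n l i) $$ (a, k)" .
qed (use diag_block_carrier_index[of l A n, OF A] carrier_matD[OF A[OF i]] in auto)

section \<open>Geometry of pairs of subspaces\<close>

lemma isometry_unitary_mult:
  assumes U: "U \<in> carrier (unitary_group d)" and \<Phi>: "is_isometry d r \<Phi>"
  shows "is_isometry d r (U * \<Phi>)"
proof -
  have c: "\<Phi> \<in> carrier_mat d r" and one: "mat_adjoint \<Phi> * \<Phi> = 1\<^sub>m r"
    using \<Phi> by (auto simp: is_isometry_def)
  note [simp] = carrier_matD[OF c] unitary_groupD(2,3)[OF U]
  have "mat_adjoint (U * \<Phi>) * (U * \<Phi>) = mat_adjoint \<Phi> * ((mat_adjoint U * U) * \<Phi>)"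
    by (simp add: mat_adjoint_mult mult_assoc_dim)
  also have "\<dots> = 1\<^sub>m r"
    using c by (simp add: unitary_groupD(4)[OF U] one)
  finally show ?thesis
    using mult_carrier_mat[OF unitary_groupD(1)[OF U] c] by (simp add: is_isometry_def)
qed

lemma mat_image_mult:
  fixes A B :: "'a::semiring_0 mat"
  assumes "A \<in> carrier_mat m n" "B \<in> carrier_mat n k"
  shows "mat_image (A * B) = (\<lambda>v. A *\<^sub>v v) ` mat_image B"
  unfolding mat_image_def image_image index_mult_mat(3) carrier_matD(2)[OF assms(2)]
  by (rule image_cong[OF refl assoc_mult_mat_vec[OF assms]])

lemma isometry_onto_unitary_mult:
  assumes U: "U \<in> carrier (unitary_group d)" and \<Phi>: "isometry_onto d r \<Phi> W"
  shows "isometry_onto d r (U * \<Phi>) ((\<lambda>v. U *\<^sub>v v) ` W)"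
proof -
  have iso: "is_isometry d r \<Phi>" and im: "mat_image \<Phi> = W"
    using \<Phi> by (auto simp: isometry_onto_def)
  then have "\<Phi> \<in> carrier_mat d r" by (simp add: is_isometry_def)
  from mat_image_mult[OF unitary_groupD(1)[OF U] this] isometry_unitary_mult[OF U iso] show ?thesis
    by (simp add: isometry_onto_def im)
qed

text \<open>Cyclicity of the trace brings the outer factor \<open>mat_adjoint \<Phi>'\<close> to the
  end, so that only the two orthogonal projections remain.\<close>

lemma frobenius_norm_cross_gram:
  fixes \<Phi> \<Phi>' :: "'a::real_or_complex mat"
  assumes "\<Phi> \<in> carrier_mat d r" "\<Phi>' \<in> carrier_mat d r"
  shows "of_real ((frobenius_norm (mat_adjoint \<Phi> * \<Phi>'))\<^sup>2) =
    mat_tr ((\<Phi> * mat_adjoint \<Phi>) * (\<Phi>' * mat_adjoint \<Phi>'))"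
proof -
  note [simp] = carrier_matD[OF assms(1)] carrier_matD[OF assms(2)]
  have "of_real ((frobenius_norm (mat_adjoint \<Phi> * \<Phi>'))\<^sup>2) =
      mat_tr (mat_adjoint \<Phi>' * (\<Phi> * mat_adjoint \<Phi> * \<Phi>'))"
    unfolding mat_tr_adjoint_mult_self[symmetric] by (simp add: mat_adjoint_mult mult_assoc_dim)
  also have "\<dots> = mat_tr ((\<Phi> * mat_adjoint \<Phi> * \<Phi>') * mat_adjoint \<Phi>')"
    by (rule mat_tr_comm) auto
  finally show ?thesis by (simp add: mult_assoc_dim)
qed

text \<open>Removes the arbitrary choice in the definition: the Frobenius norm depends on the
  projections alone, and these are determined by the subspaces.\<close>

lemma chordal_dist_isometry:
  fixes \<Phi> \<Phi>' :: "'a::real_or_complex mat"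
  assumes \<Phi>: "isometry_onto d r \<Phi> W" and \<Phi>': "isometry_onto d r \<Phi>' W'"
  shows "chordal_dist d r W W' = sqrt (real r - (frobenius_norm (mat_adjoint \<Phi> * \<Phi>'))\<^sup>2)"
proof -
  define \<Theta> where "\<Theta> = (SOME \<Phi>. isometry_onto d r \<Phi> W)"
  define \<Theta>' where "\<Theta>' = (SOME \<Phi>. isometry_onto d r \<Phi> W')"
  have \<Theta>: "isometry_onto d r \<Theta> W" and \<Theta>': "isometry_onto d r \<Theta>' W'"
    using \<Phi> \<Phi>' unfolding \<Theta>_def \<Theta>'_def by (metis someI)+
  have "\<Theta> * mat_adjoint \<Theta> = \<Phi> * mat_adjoint \<Phi>" "\<Theta>' * mat_adjoint \<Theta>' = \<Phi>' * mat_adjoint \<Phi>'"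
    using orth_projection_isometry orth_projection_unique \<Phi> \<Phi>' \<Theta> \<Theta>' by blast+
  moreover have "\<Phi> \<in> carrier_mat d r" "\<Phi>' \<in> carrier_mat d r" "\<Theta> \<in> carrier_mat d r" "\<Theta>' \<in> carrier_mat d r"
    using \<Phi> \<Phi>' \<Theta> \<Theta>' by (simp_all add: isometry_onto_def is_isometry_def)
  ultimately have "of_real ((frobenius_norm (mat_adjoint \<Theta> * \<Theta>'))\<^sup>2) =
      (of_real ((frobenius_norm (mat_adjoint \<Phi> * \<Phi>'))\<^sup>2) :: 'a)"
    by (simp only: frobenius_norm_cross_gram)
  then have "(frobenius_norm (mat_adjoint \<Theta> * \<Theta>'))\<^sup>2 = (frobenius_norm (mat_adjoint \<Phi> * \<Phi>'))\<^sup>2"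
    by (simp only: of_real_eq_iff)
  then show ?thesis by (simp add: chordal_dist_def \<Theta>_def \<Theta>'_def)
qed

lemma chordal_dist_commute:
  fixes \<Phi> \<Phi>' :: "'a::real_or_complex mat"
  assumes \<Phi>: "isometry_onto d r \<Phi> W" and \<Phi>': "isometry_onto d r \<Phi>' W'"
  shows "chordal_dist d r W W' = chordal_dist d r W' W"
proof -
  have "mat_adjoint \<Phi>' * \<Phi> = mat_adjoint (mat_adjoint \<Phi> * \<Phi>')"
    using assms by (auto simp: isometry_onto_def is_isometry_def mat_adjoint_mult)
  then show ?thesis
    by (simp add: chordal_dist_isometry[OF \<Phi> \<Phi>'] chordal_dist_isometry[OF \<Phi>' \<Phi>]
        frobenius_norm_adjoint)
qed

lemma unitary_cross_gram:
  assumes U: "U \<in> carrier (unitary_group d)"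
    and c: "\<Phi> \<in> carrier_mat d r" "\<Phi>' \<in> carrier_mat d r"
  shows "mat_adjoint (U * \<Phi>) * (U * \<Phi>') = mat_adjoint \<Phi> * \<Phi>'"
proof -
  note [simp] = carrier_matD[OF c(1)] carrier_matD[OF c(2)] unitary_groupD(2,3)[OF U]
  have "mat_adjoint (U * \<Phi>) * (U * \<Phi>') = mat_adjoint \<Phi> * ((mat_adjoint U * U) * \<Phi>')"
    by (simp add: mat_adjoint_mult mult_assoc_dim)
  then show ?thesis using c by (simp add: unitary_groupD(4)[OF U])
qed

lemma chordal_dist_unitary:
  fixes \<Phi> \<Phi>' :: "'a::real_or_complex mat"
  assumes U: "U \<in> carrier (unitary_group d)"
    and \<Phi>: "isometry_onto d r \<Phi> W" and \<Phi>': "isometry_onto d r \<Phi>' W'"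
  shows "chordal_dist d r ((\<lambda>v. U *\<^sub>v v) ` W) ((\<lambda>v. U *\<^sub>v v) ` W') = chordal_dist d r W W'"
proof -
  have "\<Phi> \<in> carrier_mat d r" "\<Phi>' \<in> carrier_mat d r"
    using assms by (auto simp: isometry_onto_def is_isometry_def)
  from unitary_cross_gram[OF U this] show ?thesis
    using chordal_dist_isometry[OF isometry_onto_unitary_mult[OF U \<Phi>] isometry_onto_unitary_mult[OF U \<Phi>']]
      chordal_dist_isometry[OF \<Phi> \<Phi>'] by simp
qed

lemma alpha_isoclinic_unitary:
  assumes U: "U \<in> carrier (unitary_group d)" and "alpha_isoclinic d r \<alpha> W W'"
  shows "alpha_isoclinic d r \<alpha> ((\<lambda>v. U *\<^sub>v v) ` W) ((\<lambda>v. U *\<^sub>v v) ` W')"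
proof -
  obtain \<Phi> \<Phi>' where \<Phi>: "isometry_onto d r \<Phi> W" and \<Phi>': "isometry_onto d r \<Phi>' W'"
    and eq: "mat_adjoint (mat_adjoint \<Phi> * \<Phi>') * (mat_adjoint \<Phi> * \<Phi>') = \<alpha> \<cdot>\<^sub>m 1\<^sub>m r"
    using assms by (auto simp: alpha_isoclinic_def)
  have "\<Phi> \<in> carrier_mat d r" "\<Phi>' \<in> carrier_mat d r"
    using \<Phi> \<Phi>' by (auto simp: isometry_onto_def is_isometry_def)
  from unitary_cross_gram[OF U this] show ?thesis
    unfolding alpha_isoclinic_def
    using isometry_onto_unitary_mult[OF U \<Phi>] isometry_onto_unitary_mult[OF U \<Phi>'] eq
    by metis
qed

text \<open>For nonzero \<alpha> a rescaled adjoint is a left inverse of a square matrix, hence a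
  right inverse; for \<alpha> = 0 the matrix vanishes by definiteness. This is what makes the
  isoclinic relation symmetric.\<close>

lemma scalar_gram_commute:
  fixes M :: "'a::real_or_complex mat"
  assumes M: "M \<in> carrier_mat r r" and eq: "mat_adjoint M * M = \<alpha> \<cdot>\<^sub>m 1\<^sub>m r"
  shows "M * mat_adjoint M = \<alpha> \<cdot>\<^sub>m 1\<^sub>m r"
proof (cases "\<alpha> = 0")
  case True
  then have "mat_adjoint M * M = 0\<^sub>m r r" unfolding eq by (intro eq_matI) auto
  then have "M = 0\<^sub>m r r" by (rule adjoint_mult_self_eq_zero[OF M])
  then show ?thesis using True by (intro eq_matI) auto
next
  case False
  note [simp] = carrier_matD[OF M]
  have "(inverse \<alpha> \<cdot>\<^sub>m mat_adjoint M) * M = 1\<^sub>m r"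
    using False by (auto simp: mult_smult_dim eq intro!: eq_matI)
  then have "M * (inverse \<alpha> \<cdot>\<^sub>m mat_adjoint M) = 1\<^sub>m r"
    by (rule mat_mult_left_right_inverse[OF smult_carrier_mat[OF mat_adjoint_carrier[OF M]] M])
  then have "\<alpha> \<cdot>\<^sub>m (inverse \<alpha> \<cdot>\<^sub>m (M * mat_adjoint M)) = \<alpha> \<cdot>\<^sub>m 1\<^sub>m r"
    by (simp add: mult_smult_dim)
  moreover have "\<alpha> \<cdot>\<^sub>m (inverse \<alpha> \<cdot>\<^sub>m (M * mat_adjoint M)) = M * mat_adjoint M"
    using False by (intro eq_matI) (auto simp del: index_mult_mat(1))
  ultimately show ?thesis by simp
qed

text \<open>Exchanging the two isometries replaces the cross Gram matrix by its adjoint, so the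
  claim is that its two Gram products are the same scalar matrix.\<close>

lemma alpha_isoclinic_commute:
  assumes "alpha_isoclinic d r \<alpha> W W'"
  shows "alpha_isoclinic d r \<alpha> W' W"
proof -
  obtain \<Phi> \<Phi>' where \<Phi>: "isometry_onto d r \<Phi> W" and \<Phi>': "isometry_onto d r \<Phi>' W'"
    and eq: "mat_adjoint (mat_adjoint \<Phi> * \<Phi>') * (mat_adjoint \<Phi> * \<Phi>') = \<alpha> \<cdot>\<^sub>m 1\<^sub>m r"
    using assms by (auto simp: alpha_isoclinic_def)
  have c: "\<Phi> \<in> carrier_mat d r" "\<Phi>' \<in> carrier_mat d r"
    using \<Phi> \<Phi>' by (auto simp: isometry_onto_def is_isometry_def)
  have "mat_adjoint (mat_adjoint \<Phi> * \<Phi>') = mat_adjoint \<Phi>' * \<Phi>"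
    using c by (auto simp: mat_adjoint_mult)
  moreover from this have "mat_adjoint (mat_adjoint \<Phi>' * \<Phi>) = mat_adjoint \<Phi> * \<Phi>'"
    by (metis mat_adjoint_adjoint)
  ultimately have "mat_adjoint (mat_adjoint \<Phi>' * \<Phi>) * (mat_adjoint \<Phi>' * \<Phi>) = \<alpha> \<cdot>\<^sub>m 1\<^sub>m r"
    using scalar_gram_commute[OF mult_carrier_mat[OF mat_adjoint_carrier[OF c(1)] c(2)] eq] by simp
  then show ?thesis
    unfolding alpha_isoclinic_def using \<Phi> \<Phi>' by blast
qed

section \<open>Sums of families of matrices\<close>

text \<open>Prescribing the dimensions gives the empty sum the right size, and the body agrees
  literally with the sum of projections in the definition of a tight fusion frame.\<close>

definition family_sum :: "nat \<Rightarrow> nat \<Rightarrow> 'x set \<Rightarrow> ('x \<Rightarrow> 'a::comm_monoid_add mat) \<Rightarrow> 'a mat" where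
  "family_sum m n X P = mat m n (\<lambda>(i, j). \<Sum>x\<in>X. P x $$ (i, j))"

lemma family_sum_carrier [simp]: "family_sum m n X P \<in> carrier_mat m n"
  and dim_family_sum [simp]: "dim_row (family_sum m n X P) = m" "dim_col (family_sum m n X P) = n"
  by (auto simp: family_sum_def)

lemma family_sum_cong:
  assumes "\<And>x. x \<in> X \<Longrightarrow> P x = Q x"
  shows "family_sum m n X P = family_sum m n X Q"
  unfolding family_sum_def using assms by (intro eq_matI) (auto intro!: sum.cong)

lemma family_sum_mult_left:
  fixes A :: "'a::semiring_0 mat"
  assumes A: "A \<in> carrier_mat k m" and P: "\<And>x. x \<in> X \<Longrightarrow> P x \<in> carrier_mat m n"
  shows "A * family_sum m n X P = family_sum k n X (\<lambda>x. A * P x)"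
proof (rule eq_matI)
  fix i j assume ij: "i < dim_row (family_sum k n X (\<lambda>x. A * P x))" "j < dim_col (family_sum k n X (\<lambda>x. A * P x))"
  have "(A * family_sum m n X P) $$ (i, j) = (\<Sum>q<m. A $$ (i, q) * (\<Sum>x\<in>X. P x $$ (q, j)))"
    using ij carrier_matD[OF A] by (simp add: mult_index family_sum_def del: index_mult_mat(1))
  also have "\<dots> = (\<Sum>x\<in>X. \<Sum>q<m. A $$ (i, q) * P x $$ (q, j))"
    unfolding sum_distrib_left by (rule sum.swap)
  also have "\<dots> = (\<Sum>x\<in>X. (A * P x) $$ (i, j))"
    using ij carrier_matD[OF A] carrier_matD[OF P]
    by (intro sum.cong) (simp_all add: mult_index del: index_mult_mat(1))
  finally show "(A * family_sum m n X P) $$ (i, j) = family_sum k n X (\<lambda>x. A * P x) $$ (i, j)"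
    using ij by (simp add: family_sum_def del: index_mult_mat(1))
qed (use carrier_matD[OF A] in auto)

lemma family_sum_mult_right:
  fixes A :: "'a::semiring_0 mat"
  assumes A: "A \<in> carrier_mat n k" and P: "\<And>x. x \<in> X \<Longrightarrow> P x \<in> carrier_mat m n"
  shows "family_sum m n X P * A = family_sum m k X (\<lambda>x. P x * A)"
proof (rule eq_matI)
  fix i j assume ij: "i < dim_row (family_sum m k X (\<lambda>x. P x * A))" "j < dim_col (family_sum m k X (\<lambda>x. P x * A))"
  have "(family_sum m n X P * A) $$ (i, j) = (\<Sum>q<n. (\<Sum>x\<in>X. P x $$ (i, q)) * A $$ (q, j))"
    using ij carrier_matD[OF A] by (simp add: mult_index family_sum_def del: index_mult_mat(1))
  also have "\<dots> = (\<Sum>x\<in>X. \<Sum>q<n. P x $$ (i, q) * A $$ (q, j))"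
    unfolding sum_distrib_right by (rule sum.swap)
  also have "\<dots> = (\<Sum>x\<in>X. (P x * A) $$ (i, j))"
    using ij carrier_matD[OF A] carrier_matD[OF P]
    by (intro sum.cong) (simp_all add: mult_index del: index_mult_mat(1))
  finally show "(family_sum m n X P * A) $$ (i, j) = family_sum m k X (\<lambda>x. P x * A) $$ (i, j)"
    using ij by (simp add: family_sum_def del: index_mult_mat(1))
qed (use carrier_matD[OF A] in auto)

lemma family_sum_adjoint:
  assumes "finite X" and P: "\<And>x. x \<in> X \<Longrightarrow> P x \<in> carrier_mat m n"
  shows "mat_adjoint (family_sum m n X P) = family_sum n m X (\<lambda>x. mat_adjoint (P x))"
  using carrier_matD[OF P] assms(1)
  by (intro eq_matI) (auto simp: family_sum_def sum_conjugate intro!: sum.cong)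

lemma mat_tr_family_sum:
  assumes P: "\<And>x. x \<in> X \<Longrightarrow> P x \<in> carrier_mat n n"
  shows "mat_tr (family_sum n n X P) = (\<Sum>x\<in>X. mat_tr (P x))"
proof -
  have "mat_tr (family_sum n n X P) = (\<Sum>i<n. \<Sum>x\<in>X. P x $$ (i, i))"
    by (simp add: mat_tr_def family_sum_def)
  also have "\<dots> = (\<Sum>x\<in>X. \<Sum>i<n. P x $$ (i, i))" by (rule sum.swap)
  also have "\<dots> = (\<Sum>x\<in>X. mat_tr (P x))"
    using carrier_matD[OF P] by (intro sum.cong) (simp_all add: mat_tr_def)
  finally show ?thesis .
qed

lemma family_sum_reindex:
  assumes "bij_betw s X X"
  shows "family_sum m n X (\<lambda>x. P (s x)) = family_sum m n X P"
  unfolding family_sum_def using sum.reindex_bij_betw[OF assms, of "\<lambda>x. P x $$ _"] by simp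

section \<open>Orbits of a subspace under a unitary representation\<close>

text \<open>Separates the geometry of an orbit from representation theory: R is any unitary
  representation whose restriction to the stabilizer of x0 preserves W. Irreducibility and blocks
  enter only later, to show that \<open>frame_op\<close> is scalar.\<close>

locale orbit_ensemble = transitive_action G X \<sigma>
  for G :: "('g, 'b) monoid_scheme" and X :: "'x set" and \<sigma> :: "'g \<Rightarrow> 'x \<Rightarrow> 'x" +
  fixes x0 :: 'x and t :: "'x \<Rightarrow> 'g" and d r :: nat
    and R :: "'g \<Rightarrow> 'a::real_or_complex mat" and \<Psi> :: "'a mat" and W :: "'a vec set"
  assumes x0: "x0 \<in> X"
    and t: "\<And>x. x \<in> X \<Longrightarrow> t x \<in> carrier G" "\<And>x. x \<in> X \<Longrightarrow> \<sigma> (t x) x0 = x"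
    and R: "R \<in> hom G (unitary_group d)"
    and \<Psi>: "isometry_onto d r \<Psi> W"
    and stab: "\<And>h. h \<in> stabilizer G \<sigma> x0 \<Longrightarrow> (\<lambda>v. R h *\<^sub>v v) ` W = W"
begin

definition ens :: "'x \<Rightarrow> 'a vec set" where
  "ens x = (\<lambda>v. R (t x) *\<^sub>v v) ` W"

definition frm :: "'x \<Rightarrow> 'a mat" where
  "frm x = R (t x) * \<Psi>"

definition proj :: "'x \<Rightarrow> 'a mat" where
  "proj x = frm x * mat_adjoint (frm x)"

definition frame_op :: "'a mat" where
  "frame_op = family_sum d d X proj"

sublocale grp: group G
  using group_hom group_hom.axioms(1) by blast

lemma R_unitary: "g \<in> carrier G \<Longrightarrow> R g \<in> carrier (unitary_group d)"
  using R by (auto simp: hom_def)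

lemma R_mult: "g \<in> carrier G \<Longrightarrow> h \<in> carrier G \<Longrightarrow> R (g \<otimes>\<^bsub>G\<^esub> h) = R g * R h"
  using R by (auto simp: hom_def unitary_group_def)

lemma W_carrier: "W \<subseteq> carrier_vec d"
  using \<Psi> by (auto simp: isometry_onto_def is_isometry_def mat_image_def)

lemma R_image_image:
  assumes "g \<in> carrier G" "h \<in> carrier G"
  shows "(\<lambda>v. R g *\<^sub>v v) ` (\<lambda>v. R h *\<^sub>v v) ` W = (\<lambda>v. R (g \<otimes>\<^bsub>G\<^esub> h) *\<^sub>v v) ` W"
  unfolding image_image R_mult[OF assms]
proof (rule image_cong[OF refl])
  fix v assume "v \<in> W"
  then have "v \<in> carrier_vec d" using W_carrier by blast
  then show "R g *\<^sub>v (R h *\<^sub>v v) = R g * R h *\<^sub>v v"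
    by (rule assoc_mult_mat_vec[symmetric, OF unitary_groupD(1) unitary_groupD(1), OF R_unitary R_unitary, OF assms])
qed

text \<open>With y = g x0, the element \<open>inv (t y)\<close> times g fixes x0 and hence preserves
  W. So a translate of W depends only on the point reached, not on the group element reaching
  it.\<close>

lemma R_image_W:
  assumes g: "g \<in> carrier G"
  shows "(\<lambda>v. R g *\<^sub>v v) ` W = ens (\<sigma> g x0)"
proof -
  let ?y = "\<sigma> g x0"
  have y: "?y \<in> X" using element_image[OF g x0 refl] .
  let ?h = "inv\<^bsub>G\<^esub> (t ?y) \<otimes>\<^bsub>G\<^esub> g"
  have h: "?h \<in> carrier G" using g t(1)[OF y] by simp
  have "\<sigma> ?h x0 = \<sigma> (inv\<^bsub>G\<^esub> (t ?y)) ?y"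
    using composition_rule[OF x0 _ g] t(1)[OF y] by simp
  also have "\<dots> = x0" using orbit_sym_aux[OF t(1)[OF y] x0 t(2)[OF y]] .
  finally have "?h \<in> stabilizer G \<sigma> x0" using h by (simp add: stabilizer_def)
  then have "(\<lambda>v. R ?h *\<^sub>v v) ` W = W" by (rule stab)
  then have "ens ?y = (\<lambda>v. R (t ?y) *\<^sub>v v) ` (\<lambda>v. R ?h *\<^sub>v v) ` W"
    by (simp add: ens_def)
  also have "\<dots> = (\<lambda>v. R (t ?y \<otimes>\<^bsub>G\<^esub> ?h) *\<^sub>v v) ` W"
    by (rule R_image_image[OF t(1)[OF y] h])
  also have "t ?y \<otimes>\<^bsub>G\<^esub> ?h = g"
    using g t(1)[OF y] by (simp flip: grp.m_assoc)
  finally show ?thesis by simp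
qed

lemma R_image_ens:
  assumes "g \<in> carrier G" "x \<in> X"
  shows "(\<lambda>v. R g *\<^sub>v v) ` ens x = ens (\<sigma> g x)"
proof -
  have "(\<lambda>v. R g *\<^sub>v v) ` ens x = (\<lambda>v. R (g \<otimes>\<^bsub>G\<^esub> t x) *\<^sub>v v) ` W"
    unfolding ens_def by (rule R_image_image[OF assms(1) t(1)[OF assms(2)]])
  also have "\<dots> = ens (\<sigma> (g \<otimes>\<^bsub>G\<^esub> t x) x0)"
    using assms t(1) by (intro R_image_W) simp
  also have "\<sigma> (g \<otimes>\<^bsub>G\<^esub> t x) x0 = \<sigma> g x"
    using composition_rule[OF x0 assms(1) t(1)[OF assms(2)]] t(2)[OF assms(2)] by simp
  finally show ?thesis .
qed

lemma ens_x0: "ens x0 = W"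
  using stab[of "t x0"] t[OF x0] by (simp add: ens_def stabilizer_def)

lemma frm_isometry:
  assumes "x \<in> X"
  shows "isometry_onto d r (frm x) (ens x)"
  unfolding frm_def ens_def
  by (rule isometry_onto_unitary_mult[OF R_unitary[OF t(1)[OF assms]] \<Psi>])

lemma frm_carrier: "x \<in> X \<Longrightarrow> frm x \<in> carrier_mat d r"
  using frm_isometry by (simp add: isometry_onto_def is_isometry_def)

lemma proj_carrier: "x \<in> X \<Longrightarrow> proj x \<in> carrier_mat d d"
  unfolding proj_def using mult_carrier_mat[OF frm_carrier mat_adjoint_carrier[OF frm_carrier]] .

lemma automorphisms: "\<sigma> ` carrier G \<subseteq> ensemble_automorphisms d X ens"
proof
  fix s assume "s \<in> \<sigma> ` carrier G"
  then obtain g where g: "g \<in> carrier G" "s = \<sigma> g" by blast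
  then have "s \<in> carrier (BijGroup X)" using bij_prop0 by (simp add: BijGroup_def)
  then show "s \<in> ensemble_automorphisms d X ens"
    unfolding ensemble_automorphisms_def using g R_unitary R_image_ens by blast
qed

lemma frame_op_adjoint:
  assumes "finite X"
  shows "mat_adjoint frame_op = frame_op"
proof -
  have "mat_adjoint frame_op = family_sum d d X (\<lambda>x. mat_adjoint (proj x))"
    unfolding frame_op_def by (rule family_sum_adjoint[OF assms proj_carrier])
  also have "\<dots> = frame_op"
    unfolding frame_op_def by (rule family_sum_cong) (simp add: proj_def mat_adjoint_mult)
  finally show ?thesis .
qed

text \<open>Conjugation by R g only permutes the projections in the sum, because g permutes X.
  Invariance under conjugation is then turned into commutation by cancelling the unitary
  factor.\<close>

lemma frame_op_commutes:
  assumes g: "g \<in> carrier G"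
  shows "R g * frame_op = frame_op * R g"
proof -
  note u = unitary_groupD[OF R_unitary[OF g]]
  note [simp] = u(2,3)
  \<comment> \<open>The isometries \<open>R g * frm x\<close> and \<open>frm (\<sigma> g x)\<close>
    may differ, but they have the same image, and uniqueness of the orthogonal projection identifies
    the two products.\<close>
  have proj: "R g * proj x * mat_adjoint (R g) = proj (\<sigma> g x)" if x: "x \<in> X" for x
  proof -
    note [simp] = carrier_matD[OF frm_carrier[OF x]]
    have "isometry_onto d r (R g * frm x) (ens (\<sigma> g x))"
      using isometry_onto_unitary_mult[OF R_unitary[OF g] frm_isometry[OF x]]
        R_image_ens[OF g x] by simp
    then have "(R g * frm x) * mat_adjoint (R g * frm x) = frm (\<sigma> g x) * mat_adjoint (frm (\<sigma> g x))"
      using frm_isometry[OF element_image[OF g x refl]]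
        orth_projection_isometry orth_projection_unique by blast
    then show ?thesis by (simp add: proj_def mat_adjoint_mult mult_assoc_dim)
  qed
  have "R g * frame_op = family_sum d d X (\<lambda>x. R g * proj x)"
    unfolding frame_op_def by (rule family_sum_mult_left[OF u(1) proj_carrier])
  then have "R g * frame_op * mat_adjoint (R g) =
      family_sum d d X (\<lambda>x. R g * proj x) * mat_adjoint (R g)" by simp
  also have "\<dots> = family_sum d d X (\<lambda>x. R g * proj x * mat_adjoint (R g))"
    by (rule family_sum_mult_right[OF mat_adjoint_carrier[OF u(1)] mult_carrier_mat[OF u(1) proj_carrier]])
  also have "\<dots> = family_sum d d X (\<lambda>x. proj (\<sigma> g x))"
    by (rule family_sum_cong) (rule proj)
  also have "\<dots> = frame_op"
    unfolding frame_op_def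
    by (rule family_sum_reindex) (use bij_prop0[OF g] in \<open>simp add: Bij_def\<close>)
  finally have "R g * frame_op * mat_adjoint (R g) * R g = frame_op * R g" by simp
  moreover have "R g * frame_op * mat_adjoint (R g) * R g = R g * (frame_op * (mat_adjoint (R g) * R g))"
    by (simp add: mult_assoc_dim frame_op_def)
  ultimately show ?thesis
    by (simp add: u(4) frame_op_def)
qed

lemma tight_fusion_frame_ens:
  assumes "frame_op = c \<cdot>\<^sub>m 1\<^sub>m d"
  shows "tight_fusion_frame d r X ens"
  unfolding tight_fusion_frame_def
proof (intro conjI ballI exI)
  show "is_subspace d (ens x)" "subspace_dim d (ens x) = r" if "x \<in> X" for x
    using subspace_dim_isometry[OF frm_isometry[OF that]] .
  show "orth_projection d (proj x) (ens x)" if "x \<in> X" for x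
    unfolding proj_def by (rule orth_projection_isometry[OF frm_isometry[OF that]])
  show "mat d d (\<lambda>(i, j). \<Sum>x\<in>X. proj x $$ (i, j)) = c \<cdot>\<^sub>m 1\<^sub>m d"
    using assms unfolding frame_op_def family_sum_def .
qed

text \<open>Double homogeneity controls unordered pairs only: g may map (x, y) to (y', x'), which is
  why Q must be symmetric on the ensemble. A generic Q serves both distances and
  isoclinicity.\<close>

lemma doubly_homogeneous_transfer:
  assumes dh: "doubly_homogeneous G X \<sigma>"
    and sym: "\<And>x y. x \<in> X \<Longrightarrow> y \<in> X \<Longrightarrow> Q (ens x) (ens y) \<Longrightarrow> Q (ens y) (ens x)"
    and inv: "\<And>g x y. g \<in> carrier G \<Longrightarrow> x \<in> X \<Longrightarrow> y \<in> X \<Longrightarrow> Q (ens x) (ens y) \<Longrightarrow>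
      Q ((\<lambda>v. R g *\<^sub>v v) ` ens x) ((\<lambda>v. R g *\<^sub>v v) ` ens y)"
    and xy: "x \<in> X" "y \<in> X" "x \<noteq> y" "Q (ens x) (ens y)"
    and xy': "x' \<in> X" "y' \<in> X" "x' \<noteq> y'"
  shows "Q (ens x') (ens y')"
proof -
  obtain g where g: "g \<in> carrier G" "{\<sigma> g x, \<sigma> g y} = {x', y'}"
    using dh xy xy' unfolding doubly_homogeneous_def by blast
  have "Q (ens (\<sigma> g x)) (ens (\<sigma> g y))"
    using inv[OF g(1) xy(1,2,4)] R_image_ens g(1) xy(1,2) by simp
  moreover have "\<sigma> g x = x' \<and> \<sigma> g y = y' \<or> \<sigma> g x = y' \<and> \<sigma> g y = x'"
    using g(2) by (auto simp: doubleton_eq_iff)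
  ultimately show ?thesis using sym xy' by metis
qed

lemma equi_chordal_ens:
  assumes dh: "doubly_homogeneous G X \<sigma>"
  shows "equi_chordal d r X ens"
proof (cases "\<exists>x\<in>X. \<exists>y\<in>X. x \<noteq> y")
  case True
  then obtain x y where xy: "x \<in> X" "y \<in> X" "x \<noteq> y" by blast
  \<comment> \<open>Q compares with the distance of one fixed reference pair, which becomes the
    common value.\<close>
  let ?Q = "\<lambda>V V'. chordal_dist d r V V' = chordal_dist d r (ens x) (ens y)"
  have "?Q (ens x') (ens y')" if "x' \<in> X" "y' \<in> X" "x' \<noteq> y'" for x' y'
    using doubly_homogeneous_transfer[OF dh, of ?Q x y x' y'] xy that frm_isometry R_unitary
      chordal_dist_commute chordal_dist_unitary by metis
  then show ?thesis unfolding equi_chordal_def by blast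
next
  case False
  then show ?thesis unfolding equi_chordal_def by blast
qed

lemma equi_isoclinic_ens_iff:
  assumes dh: "doubly_homogeneous G X \<sigma>" and two: "card X \<ge> 2"
  shows "equi_isoclinic d r X ens \<longleftrightarrow>
    (\<exists>g \<in> carrier G - stabilizer G \<sigma> x0. isoclinic d r W ((\<lambda>v. R g *\<^sub>v v) ` W))"
proof
  assume "equi_isoclinic d r X ens"
  then obtain \<alpha> where \<alpha>: "\<And>x y. x \<in> X \<Longrightarrow> y \<in> X \<Longrightarrow> x \<noteq> y \<Longrightarrow> alpha_isoclinic d r \<alpha> (ens x) (ens y)"
    unfolding equi_isoclinic_def by blast
  \<comment> \<open>A second point x supplies the witness \<open>t x\<close>, which moves x0 and so
    lies outside the stabilizer. With a single point equi-isoclinicity would hold vacuously while no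
    such group element exists.\<close>
  have "\<not> X \<subseteq> {x0}"
    using two card_mono[of "{x0}" X] by auto
  then obtain x where x: "x \<in> X" "x \<noteq> x0" by blast
  have "isoclinic d r W ((\<lambda>v. R (t x) *\<^sub>v v) ` W)"
    using \<alpha>[OF x0 x(1)] x(2) R_image_W[OF t(1)[OF x(1)]] t(2)[OF x(1)]
    by (auto simp: isoclinic_def ens_x0)
  moreover have "t x \<in> carrier G - stabilizer G \<sigma> x0"
    using t x by (simp add: stabilizer_def)
  ultimately show "\<exists>g \<in> carrier G - stabilizer G \<sigma> x0. isoclinic d r W ((\<lambda>v. R g *\<^sub>v v) ` W)"
    by blast
next
  assume "\<exists>g \<in> carrier G - stabilizer G \<sigma> x0. isoclinic d r W ((\<lambda>v. R g *\<^sub>v v) ` W)"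
  then obtain g \<alpha> where g: "g \<in> carrier G" "\<sigma> g x0 \<noteq> x0"
    and \<alpha>: "alpha_isoclinic d r \<alpha> W ((\<lambda>v. R g *\<^sub>v v) ` W)"
    by (auto simp: isoclinic_def stabilizer_def)
  \<comment> \<open>Since g moves x0, the points x0 and \<open>\<sigma> g x0\<close> are distinct
    and form the reference pair for the transfer.\<close>
  have base: "alpha_isoclinic d r \<alpha> (ens x0) (ens (\<sigma> g x0))"
    using \<alpha> by (simp add: ens_x0 R_image_W[OF g(1)])
  have "alpha_isoclinic d r \<alpha> (ens x) (ens y)" if "x \<in> X" "y \<in> X" "x \<noteq> y" for x y
    using doubly_homogeneous_transfer[OF dh, of "alpha_isoclinic d r \<alpha>" x0 "\<sigma> g x0" x y]
      alpha_isoclinic_commute alpha_isoclinic_unitary R_unitary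
      x0 element_image[OF g(1) x0 refl] g(2) base that by metis
  then show "equi_isoclinic d r X ens" unfolding equi_isoclinic_def by blast
qed

end

section \<open>Stacking isometries and block-diagonal representations\<close>

text \<open>Only one of the two products is computed, blockwise, where the selectors pass through D
  as the unitaries A i and A j; the other follows because D is square.\<close>

lemma diag_block_unitary:
  fixes A :: "nat \<Rightarrow> 'a::conjugatable_field mat"
  assumes A: "\<And>i. i < l \<Longrightarrow> A i \<in> carrier (unitary_group (n i))"
  shows "diag_block_mat (map A [0..<l]) \<in> carrier (unitary_group (\<Sum>i<l. n i))"
proof -
  let ?D = "diag_block_mat (map A [0..<l])" and ?d = "\<Sum>i<l. n i"
  let ?E = "block_sel n l :: nat \<Rightarrow> 'a mat"
  note u = unitary_groupD[OF A]
  have D: "?D \<in> carrier_mat ?d ?d"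
    using diag_block_carrier_index[of l A n] u(1) by blast
  note [simp] = carrier_matD[OF D] u(2,3)
  have ED: "?E i * ?D = A i * ?E i" if "i < l" for i
    using block_sel_mult_diag_block[of l A n] u(1) that by blast
  have "?D * mat_adjoint ?D = 1\<^sub>m ?d"
  proof (rule block_sel_eqI2)
    fix i j assume i: "i < l" and j: "j < l"
    have "?E i * (?D * mat_adjoint ?D) * mat_adjoint (?E j) =
        (?E i * ?D) * mat_adjoint (?E j * ?D)"
      by (simp add: mult_assoc_dim mat_adjoint_mult)
    also have "\<dots> = A i * (?E i * mat_adjoint (?E j)) * mat_adjoint (A j)"
      using i j by (simp add: ED mult_assoc_dim mat_adjoint_mult)
    also have "\<dots> = ?E i * mat_adjoint (?E j)"
      using i j u(1,5) by (auto simp: block_sel_mult_adjoint)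
    also have "\<dots> = ?E i * 1\<^sub>m ?d * mat_adjoint (?E j)" by simp
    finally show "?E i * (?D * mat_adjoint ?D) * mat_adjoint (?E j) =
        ?E i * 1\<^sub>m ?d * mat_adjoint (?E j)" .
  qed (use mult_carrier_mat[OF D mat_adjoint_carrier[OF D]] in auto)
  then show ?thesis
    using D mat_mult_left_right_inverse[OF D mat_adjoint_carrier[OF D]]
    by (simp add: unitary_group_def)
qed

lemma diag_block_mult:
  fixes A B :: "nat \<Rightarrow> 'a::semiring_1 mat"
  assumes A: "\<And>i. i < l \<Longrightarrow> A i \<in> carrier_mat (n i) (n i)"
    and B: "\<And>i. i < l \<Longrightarrow> B i \<in> carrier_mat (n i) (n i)"
  shows "diag_block_mat (map (\<lambda>i. A i * B i) [0..<l]) =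
    diag_block_mat (map A [0..<l]) * diag_block_mat (map B [0..<l])"
proof -
  let ?D = "\<lambda>A. diag_block_mat (map A [0..<l])" and ?d = "\<Sum>i<l. n i"
  let ?E = "block_sel n l :: nat \<Rightarrow> 'a mat"
  have AB: "A i * B i \<in> carrier_mat (n i) (n i)" if "i < l" for i
    using mult_carrier_mat[OF A[OF that] B[OF that]] .
  have D: "?D A \<in> carrier_mat ?d ?d" "?D B \<in> carrier_mat ?d ?d" "?D (\<lambda>i. A i * B i) \<in> carrier_mat ?d ?d"
    using diag_block_carrier_index[of l A n, OF A] diag_block_carrier_index[of l B n, OF B]
      diag_block_carrier_index[of l "\<lambda>i. A i * B i" n, OF AB] by blast+
  note [simp] = carrier_matD[OF D(1)] carrier_matD[OF D(2)] carrier_matD[OF A] carrier_matD[OF B]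
  show ?thesis
  proof (rule block_sel_eqI[OF D(3) mult_carrier_mat[OF D(1,2)]])
    fix i assume i: "i < l"
    have "?E i * ?D (\<lambda>i. A i * B i) = A i * (B i * ?E i)"
      using i by (simp add: block_sel_mult_diag_block[of l "\<lambda>i. A i * B i" n, OF AB] mult_assoc_dim)
    also have "\<dots> = A i * (?E i * ?D B)"
      using block_sel_mult_diag_block[of l B n i, OF B i] by simp
    also have "\<dots> = (A i * ?E i) * ?D B" using i by (simp add: mult_assoc_dim)
    also have "\<dots> = (?E i * ?D A) * ?D B"
      using block_sel_mult_diag_block[of l A n i, OF A i] by simp
    finally show "?E i * ?D (\<lambda>i. A i * B i) = ?E i * (?D A * ?D B)" by (simp add: mult_assoc_dim)
  qed
qed

lemma diag_block_hom:
  fixes \<rho> :: "nat \<Rightarrow> 'g \<Rightarrow> 'a::conjugatable_field mat"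
  assumes \<rho>: "\<And>i. i < l \<Longrightarrow> \<rho> i \<in> hom G (unitary_group (n i))"
  shows "(\<lambda>g. diag_block_mat (map (\<lambda>i. \<rho> i g) [0..<l])) \<in> hom G (unitary_group (\<Sum>i<l. n i))"
proof (rule homI)
  have u: "\<rho> i g \<in> carrier (unitary_group (n i))" if "i < l" "g \<in> carrier G" for i g
    using \<rho> that by (auto simp: hom_def)
  let ?D = "\<lambda>g. diag_block_mat (map (\<lambda>i. \<rho> i g) [0..<l])"
  show "?D g \<in> carrier (unitary_group (\<Sum>i<l. n i))" if "g \<in> carrier G" for g
    using u that by (intro diag_block_unitary)
  fix g h assume g: "g \<in> carrier G" and h: "h \<in> carrier G"
  have eq: "map (\<lambda>i. \<rho> i (g \<otimes>\<^bsub>G\<^esub> h)) [0..<l] = map (\<lambda>i. \<rho> i g * \<rho> i h) [0..<l]"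
    using \<rho> g h by (auto simp: hom_def unitary_group_def)
  show "?D (g \<otimes>\<^bsub>G\<^esub> h) = ?D g \<otimes>\<^bsub>unitary_group (\<Sum>i<l. n i)\<^esub> ?D h"
    unfolding eq using diag_block_mult[of l "\<lambda>i. \<rho> i g" n "\<lambda>i. \<rho> i h", OF unitary_groupD(1)[OF u] unitary_groupD(1)[OF u]] g h
    by (simp add: unitary_group_def)
qed

text \<open>Splitting the summation over rows by blocks makes Gram matrices additive. The entrywise
  form keeps the right-hand side an ordinary sum of scalars.\<close>

lemma stack_rows_adjoint_mult_self:
  fixes A :: "nat \<Rightarrow> 'a::conjugatable_field mat"
  assumes A: "\<And>i. i < l \<Longrightarrow> A i \<in> carrier_mat (n i) r" and a: "a < r" and b: "b < r"
  shows "(mat_adjoint (stack_rows r (map A [0..<l])) * stack_rows r (map A [0..<l])) $$ (a, b) =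
    (\<Sum>i<l. (mat_adjoint (A i) * A i) $$ (a, b))"
proof -
  let ?S = "stack_rows r (map A [0..<l])"
  have S: "?S \<in> carrier_mat (\<Sum>i<l. n i) r"
    and idx: "\<And>i k b. i < l \<Longrightarrow> k < n i \<Longrightarrow> b < r \<Longrightarrow> ?S $$ ((\<Sum>j<i. n j) + k, b) = A i $$ (k, b)"
    using stack_rows_carrier_index[of l A n r, OF A] by blast+
  have "(mat_adjoint ?S * ?S) $$ (a, b) =
      (\<Sum>k<(\<Sum>i<l. n i). conjugate (?S $$ (k, a)) * ?S $$ (k, b))"
    using carrier_matD[OF S] a b by (simp add: mult_index del: index_mult_mat(1))
  also have "\<dots> = (\<Sum>i<l. \<Sum>k<n i. conjugate (A i $$ (k, a)) * A i $$ (k, b))"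
    unfolding sum_blocks using idx a b by (intro sum.cong refl) auto
  also have "\<dots> = (\<Sum>i<l. (mat_adjoint (A i) * A i) $$ (a, b))"
    using carrier_matD[OF A] a b by (intro sum.cong refl) (simp add: mult_index del: index_mult_mat(1))
  finally show ?thesis .
qed

text \<open>Needed for the stabilizer: composing an isometry on the right with a unitary must not
  change its image.\<close>

lemma mat_image_unitary:
  assumes "U \<in> carrier (unitary_group r)"
  shows "mat_image U = carrier_vec r"
proof (intro subset_antisym subsetI)
  note u = unitary_groupD[OF assms]
  show "v \<in> carrier_vec r" if "v \<in> mat_image U" for v
    using that u(1) by (auto simp: mat_image_def)
  fix v :: "'a vec" assume v: "v \<in> carrier_vec r"
  have "U *\<^sub>v (mat_adjoint U *\<^sub>v v) = v"
    using assoc_mult_mat_vec[OF u(1) mat_adjoint_carrier[OF u(1)] v] u(5) v by simp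
  moreover have "mat_adjoint U *\<^sub>v v \<in> carrier_vec (dim_col U)"
    using mult_mat_vec_carrier[OF mat_adjoint_carrier[OF u(1)] v] u(3) by simp
  ultimately show "v \<in> mat_image U"
    unfolding mat_image_def by (metis imageI)
qed

text \<open>Each block contributes its squared weight times the identity to the Gram matrix, and the
  squared weights n_i/d add up to 1.\<close>

lemma weighted_stack_isometry:
  fixes \<Psi>i :: "nat \<Rightarrow> 'a::real_or_complex mat"
  assumes iso: "\<And>i. i < l \<Longrightarrow> is_isometry (n i) r (\<Psi>i i)"
    and d: "d = (\<Sum>i<l. n i)" "d > 0"
  shows "is_isometry d r (stack_rows r (map (\<lambda>i. of_real (sqrt (real (n i) / real d)) \<cdot>\<^sub>m \<Psi>i i) [0..<l]))"
proof -
  define A where "A = (\<lambda>i. of_real (sqrt (real (n i) / real d)) \<cdot>\<^sub>m \<Psi>i i)"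
  let ?S = "stack_rows r (map A [0..<l])"
  have P: "\<Psi>i i \<in> carrier_mat (n i) r" "mat_adjoint (\<Psi>i i) * \<Psi>i i = 1\<^sub>m r" if "i < l" for i
    using iso[OF that] by (auto simp: is_isometry_def)
  have A: "A i \<in> carrier_mat (n i) r" if "i < l" for i
    using P(1)[OF that] by (simp add: A_def)
  have S: "?S \<in> carrier_mat d r"
    using stack_rows_carrier_index[of l A n r, OF A] d by blast
  have gram: "mat_adjoint (A i) * A i = of_real (real (n i) / real d) \<cdot>\<^sub>m 1\<^sub>m r" if "i < l" for i
  proof -
    let ?c = "of_real (sqrt (real (n i) / real d)) :: 'a"
    have "mat_adjoint (A i) * A i = ?c \<cdot>\<^sub>m (?c \<cdot>\<^sub>m 1\<^sub>m r)"
      by (simp add: A_def mat_adjoint_smult mult_smult_dim P(2)[OF that])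
    also have "\<dots> = (?c * ?c) \<cdot>\<^sub>m 1\<^sub>m r" by (intro eq_matI) auto
    also have "?c * ?c = of_real (real (n i) / real d)"
      unfolding of_real_mult[symmetric] by simp
    finally show ?thesis .
  qed
  have "mat_adjoint ?S * ?S = 1\<^sub>m r"
  proof (rule eq_matI)
    fix a b assume ab: "a < dim_row (1\<^sub>m r :: 'a mat)" "b < dim_col (1\<^sub>m r :: 'a mat)"
    have "(mat_adjoint ?S * ?S) $$ (a, b) = (\<Sum>i<l. (mat_adjoint (A i) * A i) $$ (a, b))"
      using ab by (intro stack_rows_adjoint_mult_self[OF A]) auto
    also have "\<dots> = (\<Sum>i<l. of_real (real (n i) / real d) * (1\<^sub>m r :: 'a mat) $$ (a, b))"
      using ab by (intro sum.cong refl) (auto simp: gram simp del: index_mult_mat(1))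
    also have "\<dots> = of_real ((\<Sum>i<l. real (n i)) / real d) * (1\<^sub>m r :: 'a mat) $$ (a, b)"
      by (simp only: sum_distrib_right[symmetric] of_real_sum[symmetric] sum_divide_distrib[symmetric])
    also have "(\<Sum>i<l. real (n i)) = real d"
      by (simp add: d(1))
    finally show "(mat_adjoint ?S * ?S) $$ (a, b) = (1\<^sub>m r :: 'a mat) $$ (a, b)"
      using d(2) by simp
  qed (use carrier_matD[OF S] in auto)
  then show ?thesis using S by (simp add: is_isometry_def A_def)
qed

theorem theorem3p9:
  fixes G :: "('g, 'b) monoid_scheme"
    and X :: "'x set"
    and \<sigma> :: "'g \<Rightarrow> 'x \<Rightarrow> 'x"
    and x0 :: 'x
    and H :: "'g set"
    and t :: "'x \<Rightarrow> 'g"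
    and l r d :: nat
    and n :: "nat \<Rightarrow> nat"
    and \<rho>i :: "nat \<Rightarrow> 'g \<Rightarrow> 'a::real_or_complex mat"
    and \<pi> :: "'g \<Rightarrow> 'a mat"
    and \<Psi>i :: "nat \<Rightarrow> 'a mat"
    and \<rho> :: "'g \<Rightarrow> 'a mat"
    and \<Psi> :: "'a mat"
    and W :: "'a vec set"
    and \<W> :: "'x \<Rightarrow> 'a vec set"
  assumes "finite (carrier G)" and "finite X"
    and "transitive_action G X \<sigma>"
    and "x0 \<in> X" and H: "H = stabilizer G \<sigma> x0"
    and "\<And>x. x \<in> X \<Longrightarrow> t x \<in> carrier G \<and> \<sigma> (t x) x0 = x"
    and "l \<ge> 1"
    and "\<And>i. i < l \<Longrightarrow> \<rho>i i \<in> hom G (unitary_group (n i)) \<and> irreducible_rep G (n i) (\<rho>i i)"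
    and "\<And>i j. i < l \<Longrightarrow> j < l \<Longrightarrow> i \<noteq> j \<Longrightarrow> \<not> equivalent_reps G (n i) (\<rho>i i) (n j) (\<rho>i j)"
    and "\<pi> \<in> hom (G\<lparr>carrier := H\<rparr>) (unitary_group r)"
    and "\<And>i. i < l \<Longrightarrow> is_isometry (n i) r (\<Psi>i i)"
    and "\<And>i h. i < l \<Longrightarrow> h \<in> H \<Longrightarrow> \<rho>i i h * \<Psi>i i = \<Psi>i i * \<pi> h"
    and d: "d = (\<Sum>i<l. n i)"
    and \<rho>: "\<rho> = (\<lambda>g. diag_block_mat (map (\<lambda>i. \<rho>i i g) [0..<l]))"
    and \<Psi>: "\<Psi> = stack_rows r (map (\<lambda>i. of_real (sqrt (real (n i) / real d)) \<cdot>\<^sub>m \<Psi>i i) [0..<l])"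
    and W: "W = mat_image \<Psi>"
    and \<W>: "\<W> = (\<lambda>x. (\<lambda>v. \<rho> (t x) *\<^sub>v v) ` W)"
  shows "isometry_onto d r \<Psi> W \<and> is_subspace d W
    \<and> tight_fusion_frame d r X \<W>
    \<and> \<sigma> ` carrier G \<subseteq> ensemble_automorphisms d X \<W>
    \<and> (doubly_homogeneous G X \<sigma> \<longrightarrow>
         equi_chordal_tff d r X \<W>
         \<and> (card X \<ge> 2 \<longrightarrow>
              (equi_isoclinic_tff d r X \<W> \<longleftrightarrow>
                (\<exists>g \<in> carrier G - H. isoclinic d r W ((\<lambda>v. \<rho> g *\<^sub>v v) ` W)))))"
proof -
  note finX = assms(2) and act = assms(3) and x0 = assms(4) and t = assms(6)
    and hom_i = assms(8)[THEN conjunct1] and irr = assms(8)[THEN conjunct2]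
    and inequiv = assms(9) and \<pi> = assms(10) and iso_i = assms(11) and inter_i = assms(12)
  let ?E = "block_sel n l :: nat \<Rightarrow> 'a mat"
  define c where "c i = (of_real (sqrt (real (n i) / real d)) :: 'a)" for i
  have csq: "c i * c i = of_real (real (n i) / real d)" for i
    unfolding c_def of_real_mult[symmetric] by simp
  have npos: "n i > 0" if "i < l" for i
    using irr[OF that] by (simp add: irreducible_rep_def)
  \<comment> \<open>With l \<ge> 1 there is a first summand, and irreducibility includes positive
    dimension.\<close>
  have dpos: "d > 0"
  proof -
    have "n 0 \<le> (\<Sum>i<l. n i)" using assms(7) by (intro member_le_sum) auto
    then show ?thesis using npos[of 0] assms(7) d by simp
  qed

  have \<Psi>i: "\<Psi>i i \<in> carrier_mat (n i) r" if "i < l" for i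
    using iso_i[OF that] by (simp add: is_isometry_def)
  have u_i: "\<rho>i i g \<in> carrier (unitary_group (n i))" if "i < l" "g \<in> carrier G" for i g
    using hom_i that by (auto simp: hom_def)
  have \<rho>_hom: "\<rho> \<in> hom G (unitary_group d)"
    unfolding \<rho> d by (rule diag_block_hom) (rule hom_i)
  have u: "\<rho> g \<in> carrier (unitary_group d)" if "g \<in> carrier G" for g
    using \<rho>_hom that by (auto simp: hom_def)
  have E_\<rho>: "?E i * \<rho> g = \<rho>i i g * ?E i" if "i < l" "g \<in> carrier G" for i g
    unfolding \<rho> using unitary_groupD(1)[OF u_i[OF _ that(2)]] that(1)
    by (intro block_sel_mult_diag_block)
  have E_\<Psi>: "?E i * \<Psi> = c i \<cdot>\<^sub>m \<Psi>i i" if "i < l" for i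
    unfolding \<Psi> c_def using \<Psi>i that by (intro block_sel_mult_stack_rows) auto
  \<comment> \<open>Folds the sum of block sizes back to d, so that the column dimension of the
    selectors matches that of \<rho> and \<Psi> during simplification.\<close>
  note d [symmetric, simp]
  have cE: "?E i \<in> carrier_mat (n i) d" for i unfolding d by (rule block_sel_carrier)

  have iso: "isometry_onto d r \<Psi> W"
    unfolding isometry_onto_def W \<Psi> using weighted_stack_isometry[OF iso_i d dpos] by simp
  then have c\<Psi>: "\<Psi> \<in> carrier_mat d r" by (simp add: isometry_onto_def is_isometry_def)
  note dims\<Psi> [simp] = carrier_matD[OF c\<Psi>]

  have H_G: "h \<in> carrier G" if "h \<in> H" for h
    using that by (simp add: H stabilizer_def)
  have \<pi>_u: "\<pi> h \<in> carrier (unitary_group r)" if "h \<in> H" for h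
    using \<pi> that by (auto simp: hom_def)
  \<comment> \<open>Checked on each block, where the scalar weight c_i commutes with everything. It
    matters that the same \<pi> serves all summands: otherwise the stack would admit no common right
    factor.\<close>
  have inter: "\<rho> h * \<Psi> = \<Psi> * \<pi> h" if h: "h \<in> H" for h
  proof (rule block_sel_eqI[where n = n and l = l])
    note [simp] = unitary_groupD(2,3)[OF \<pi>_u[OF h]] unitary_groupD(2,3)[OF u[OF H_G[OF h]]]
    show "\<rho> h * \<Psi> \<in> carrier_mat (\<Sum>j<l. n j) r" "\<Psi> * \<pi> h \<in> carrier_mat (\<Sum>j<l. n j) r"
      by (auto intro!: carrier_matI)
    fix i assume i: "i < l"
    note [simp] = unitary_groupD(2,3)[OF u_i[OF i H_G[OF h]]] carrier_matD[OF \<Psi>i[OF i]]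
    have "?E i * (\<rho> h * \<Psi>) = (?E i * \<rho> h) * \<Psi>" by (simp add: mult_assoc_dim)
    also have "\<dots> = \<rho>i i h * (?E i * \<Psi>)"
      by (simp add: E_\<rho>[OF i H_G[OF h]] mult_assoc_dim)
    also have "\<dots> = (?E i * \<Psi>) * \<pi> h"
      by (simp add: E_\<Psi>[OF i] mult_smult_dim inter_i[OF i h])
    also have "\<dots> = ?E i * (\<Psi> * \<pi> h)" by (simp add: mult_assoc_dim)
    finally show "?E i * (\<rho> h * \<Psi>) = ?E i * (\<Psi> * \<pi> h)" .
  qed
  \<comment> \<open>On the stabilizer \<rho>(h) amounts to the unitary \<pi>(h) acting on the domain
    of \<Psi>, which only reparametrizes the image.\<close>
  have stab: "(\<lambda>v. \<rho> h *\<^sub>v v) ` W = W" if h: "h \<in> stabilizer G \<sigma> x0" for h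
  proof -
    have h': "h \<in> H" using h H by simp
    have "(\<lambda>v. \<rho> h *\<^sub>v v) ` W = mat_image (\<rho> h * \<Psi>)"
      unfolding W by (rule mat_image_mult[symmetric, OF unitary_groupD(1)[OF u[OF H_G[OF h']]] c\<Psi>])
    also have "\<dots> = (\<lambda>v. \<Psi> *\<^sub>v v) ` mat_image (\<pi> h)"
      unfolding inter[OF h'] by (rule mat_image_mult[OF c\<Psi> unitary_groupD(1)[OF \<pi>_u[OF h']]])
    also have "\<dots> = W" unfolding mat_image_unitary[OF \<pi>_u[OF h']] by (simp add: W mat_image_def)
    finally show ?thesis .
  qed

  interpret orbit_ensemble G X \<sigma> x0 t d r \<rho> \<Psi> W
    unfolding orbit_ensemble_def orbit_ensemble_axioms_def
    using act x0 t \<rho>_hom iso stab by blast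
  have ens: "\<W> = ens" by (auto simp: \<W> ens_def fun_eq_iff)

  \<comment> \<open>Blocks of the frame operator\<close>
  have S: "frame_op \<in> carrier_mat d d" by (simp add: frame_op_def)
  note [simp] = carrier_matD[OF S]
  define B where "B i j = ?E i * frame_op * mat_adjoint (?E j)" for i j
  have B: "B i j \<in> carrier_mat (n i) (n j)" for i j
    by (rule carrier_matI) (simp_all add: B_def)
  have B_inter: "B i j * \<rho>i j g = \<rho>i i g * B i j" if i: "i < l" and j: "j < l" and g: "g \<in> carrier G" for i j g
  proof -
    note [simp] = unitary_groupD(2,3)[OF u_i[OF i g]] unitary_groupD(2,3)[OF u_i[OF j g]]
      unitary_groupD(2,3)[OF u[OF g]]
    have "B i j * \<rho>i j g = ?E i * (frame_op * (mat_adjoint (?E j) * \<rho>i j g))"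
      by (simp add: B_def mult_assoc_dim)
    \<comment> \<open>The adjoint of the selector relation is the inclusion of the j-th summand,
      again an intertwiner; it carries the group element across the right-hand side of the
      block.\<close>
    also have "mat_adjoint (?E j) * \<rho>i j g = \<rho> g * mat_adjoint (?E j)"
      by (rule adjoint_intertwines[OF u[OF g] u_i[OF j g] cE E_\<rho>[OF j g]])
    also have "?E i * (frame_op * (\<rho> g * mat_adjoint (?E j))) = ?E i * ((frame_op * \<rho> g) * mat_adjoint (?E j))"
      by (simp add: mult_assoc_dim)
    also have "\<dots> = (?E i * \<rho> g) * (frame_op * mat_adjoint (?E j))"
      by (simp add: frame_op_commutes[OF g, symmetric] mult_assoc_dim)
    also have "\<dots> = \<rho>i i g * B i j"
      by (simp add: E_\<rho>[OF i g] B_def mult_assoc_dim)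
    finally show ?thesis .
  qed
  \<comment> \<open>The block maps the j-th space to the i-th, so inequivalence is used for the
    ordered pair (j, i).\<close>
  have B_off: "B i j = 0\<^sub>m (n i) (n j)" if "i < l" "j < l" "i \<noteq> j" for i j
    using that by (intro intertwiner_zero[OF hom_i irr hom_i irr inequiv B B_inter]) auto

  \<comment> \<open>All x contribute the same trace: compressed to block i, the isometry
    \<open>frm x\<close> is c_i times an isometry N into the i-th space, so the contribution is
    c_i^2 times r, that is n_i r/d.\<close>
  have B_tr: "mat_tr (B i i) = of_nat (card X) * (of_real (real (n i) / real d) * of_nat r)" if i: "i < l" for i
  proof -
    have "B i i = family_sum (n i) (n i) X (\<lambda>x. ?E i * proj x * mat_adjoint (?E i))"
    proof -
      have "?E i * frame_op = family_sum (n i) d X (\<lambda>x. ?E i * proj x)"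
        unfolding frame_op_def by (rule family_sum_mult_left[OF cE proj_carrier])
      then have "B i i = family_sum (n i) d X (\<lambda>x. ?E i * proj x) * mat_adjoint (?E i)"
        by (simp add: B_def)
      also have "\<dots> = family_sum (n i) (n i) X (\<lambda>x. ?E i * proj x * mat_adjoint (?E i))"
        by (rule family_sum_mult_right[OF mat_adjoint_carrier[OF cE] mult_carrier_mat[OF cE proj_carrier]])
      finally show ?thesis .
    qed
    then have "mat_tr (B i i) = (\<Sum>x\<in>X. mat_tr (?E i * proj x * mat_adjoint (?E i)))"
      using mat_tr_family_sum[OF mult_carrier_mat[OF mult_carrier_mat[OF cE proj_carrier] mat_adjoint_carrier[OF cE]]]
      by simp
    also have "\<dots> = (\<Sum>x\<in>X. of_real (real (n i) / real d) * of_nat r)"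
    proof (rule sum.cong[OF refl])
      fix x assume x: "x \<in> X"
      have tx: "t x \<in> carrier G" using t x by blast
      define N where "N = \<rho>i i (t x) * \<Psi>i i"
      have N: "is_isometry (n i) r N"
        unfolding N_def by (rule isometry_unitary_mult[OF u_i[OF i tx] iso_i[OF i]])
      then have cN: "N \<in> carrier_mat (n i) r" and NN: "mat_adjoint N * N = 1\<^sub>m r"
        by (auto simp: is_isometry_def)
      note [simp] = unitary_groupD(2,3)[OF u_i[OF i tx]] unitary_groupD(2,3)[OF u[OF tx]]
        carrier_matD[OF cN] carrier_matD[OF \<Psi>i[OF i]] carrier_matD[OF frm_carrier[OF x]]
      have EF: "?E i * frm x = c i \<cdot>\<^sub>m N"
      proof -
        have "?E i * frm x = (?E i * \<rho> (t x)) * \<Psi>" by (simp add: frm_def mult_assoc_dim)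
        also have "\<dots> = \<rho>i i (t x) * (?E i * \<Psi>)" by (simp add: E_\<rho>[OF i tx] mult_assoc_dim)
        also have "\<dots> = c i \<cdot>\<^sub>m N" by (simp add: E_\<Psi>[OF i] mult_smult_dim N_def)
        finally show ?thesis .
      qed
      have "?E i * proj x * mat_adjoint (?E i) = (?E i * frm x) * mat_adjoint (?E i * frm x)"
        by (simp add: proj_def mult_assoc_dim mat_adjoint_mult)
      \<comment> \<open>Cyclicity trades a product of size n_i for a Gram matrix of size r, which is
        a multiple of the identity.\<close>
      then have "mat_tr (?E i * proj x * mat_adjoint (?E i)) =
          mat_tr (mat_adjoint (?E i * frm x) * (?E i * frm x))"
        using mat_tr_comm[of "?E i * frm x" "mat_adjoint (?E i * frm x)"] by simp
      also have "mat_adjoint (?E i * frm x) * (?E i * frm x) = c i \<cdot>\<^sub>m (conjugate (c i) \<cdot>\<^sub>m 1\<^sub>m r)"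
        by (simp add: EF mat_adjoint_smult mult_smult_dim NN)
      also have "\<dots> = (c i * c i) \<cdot>\<^sub>m 1\<^sub>m r"
        by (intro eq_matI) (auto simp: c_def)
      finally show "mat_tr (?E i * proj x * mat_adjoint (?E i)) = of_real (real (n i) / real d) * of_nat r"
        by (simp only: csq mat_tr_smult_one)
    qed
    finally show ?thesis by simp
  qed
  let ?b = "of_nat (card X) * of_nat r / of_nat d :: 'a"
  have B_diag: "B i i = ?b \<cdot>\<^sub>m 1\<^sub>m (n i)" if i: "i < l" for i
  proof -
    have "mat_adjoint (B i i) = B i i"
      by (simp add: B_def mat_adjoint_mult mult_assoc_dim frame_op_adjoint[OF finX])
    then obtain b where b: "B i i = b \<cdot>\<^sub>m 1\<^sub>m (n i)"
      using hermitian_intertwiner_scalar[OF irr[OF i] B _ unitary_groupD(1)[OF u_i[OF i]] B_inter[OF i i]]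
      by blast
    \<comment> \<open>The trace of the diagonal block is evaluated twice. The factor n_i occurs on
      both sides and cancels, leaving a scalar independent of i; this is the purpose of the
      weights.\<close>
    have "b * of_nat (n i) = of_nat (card X) * (of_real (real (n i) / real d) * of_nat r)"
      using B_tr[OF i] by (simp only: b mat_tr_smult_one)
    also have "\<dots> = ?b * of_nat (n i)" using dpos by (simp add: of_real_divide)
    finally have "b = ?b" unfolding mult_cancel_right using npos[OF i] by simp
    with b show ?thesis by simp
  qed
  have "frame_op = ?b \<cdot>\<^sub>m 1\<^sub>m d"
  proof (rule block_sel_eqI2[where n = n and l = l])
    show "frame_op \<in> carrier_mat (\<Sum>j<l. n j) (\<Sum>j<l. n j)"
      "?b \<cdot>\<^sub>m 1\<^sub>m d \<in> carrier_mat (\<Sum>j<l. n j) (\<Sum>j<l. n j)" using S by simp_all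
    fix i j assume i: "i < l" and j: "j < l"
    have "?E i * (?b \<cdot>\<^sub>m 1\<^sub>m d) * mat_adjoint (?E j) = ?b \<cdot>\<^sub>m (?E i * mat_adjoint (?E j))"
      using right_mult_one_mat[OF cE] by (simp add: mult_smult_dim)
    \<comment> \<open>The product of the selector of i with the adjoint of that of j is the identity
      or zero according to whether i = j, which matches the diagonal and off-diagonal blocks found
      above.\<close>
    also have "\<dots> = B i j"
      using B_diag[OF i] B_off[OF i j] by (auto simp: block_sel_mult_adjoint[OF i j] intro!: eq_matI)
    finally show "?E i * frame_op * mat_adjoint (?E j) = ?E i * (?b \<cdot>\<^sub>m 1\<^sub>m d) * mat_adjoint (?E j)"
      by (simp add: B_def)
  qed
  then have tff: "tight_fusion_frame d r X ens" by (rule tight_fusion_frame_ens)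
  show ?thesis
    unfolding ens equi_chordal_tff_def equi_isoclinic_tff_def
    using iso subspace_dim_isometry(1)[OF iso] tff automorphisms equi_chordal_ens
      equi_isoclinic_ens_iff H by blast
qed

end
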